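(* Let $n\ge1$, $\nu=q-q^{-1}$, $A=\mathcal O_q(\mathrm{SU}_{n+1})$, and let $I\subseteq A^+$ be the right ideal associated to the tangent space $T^{(0,1)}$. Write $(i,j)\in\Delta^+$ for $1\le i<j\le n+1$. A generating set for the right ideal $I$ is given by the union $G=G_1\cup G_2\cup G_3$ of $$G_1:=\{u_{ij},\ u_{kk}-1\mid(i,j)\in\Delta^+,\ k=1,\dots,n+1\},$$ $$G_2:=\{u_{ji}u_{kl}\mid(i,j),(k,l)\in\Delta^+\},$$ $$G_3:=\{u_{ji}u_{lk}\mid(i,j),(k,l)\in\Delta^+,\ j\ne k\}.$$ Moreover, for the right $A$-module structure of $\Lambda^{(0,1)}_q=A^+/I$ with basis $e_{ji}=[u_{ji}]$, the actions $$e_{ji}u_{kk}=q^{\delta_{jk}-\delta_{ik}}e_{ji},\qquad e_{ji}u_{j'j}=\nu e_{j'i},$$ for $(i,j),(j,j')\in\Delta^+$ and $k=1,\dots,n+1$, are the only non-zero actions of the generators $u_{kl}$ on the basis elements $e_{ji}$.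
   Context: All algebras are over $\mathbb C$. Fix $q\in\mathbb R$, $q\ne-1,0,1$; $[a,b]_c:=ab-c\,ba$. $U_q(\mathfrak{sl}_{n+1})$ is the standard Drinfeld--Jimbo algebra with generators $E_i,F_i,K_i^{\pm1}$, $i=1,\dots,n$ ($K_iE_j=q^{a_{ij}}E_jK_i$, $K_iF_j=q^{-a_{ij}}F_jK_i$, $E_iF_j-F_jE_i=\delta_{ij}\frac{K_i-K_i^{-1}}{q-q^{-1}}$, $K_i$'s commuting and invertible, quantum Serre relations), and coproduct $\Delta(K_i)=K_i\otimes K_i$, $\Delta(E_i)=E_i\otimes K_i+1\otimes E_i$, $\Delta(F_i)=F_i\otimes1+K_i^{-1}\otimes F_i$. $A=\mathcal O_q(\mathrm{SU}_{n+1})$ is the Hopf algebra of matrix coefficients of the finite-dimensional type-1 representations of $U_q(\mathfrak{sl}_{n+1})$. It is generated by $u_{ij}$, $i,j=1,\dots,n+1$, subject, for $i<i'$, $j<j'$, to $u_{ij}u_{i'j}=qu_{i'j}u_{ij}$, $u_{ij}u_{ij'}=qu_{ij'}u_{ij}$, $u_{ij'}u_{i'j}=u_{i'j}u_{ij'}$, $u_{ij}u_{i'j'}=u_{i'j'}u_{ij}+(q-q^{-1})u_{ij'}u_{i'j}$ and the quantum determinant relation, with $\Delta(u_{ij})=\sum_au_{ia}\otimes u_{aj}$, $\varepsilon(u_{ij})=\delta_{ij}$. The evaluation pairing satisfies $\langle E_i,u_{i+1,i}\rangle=1$, $\langle F_i,u_{i,i+1}\rangle=1$, $\langle K_j^{\pm1},u_{ii}\rangle=q^{\pm(\delta_{j+1,i}-\delta_{ij})}$,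 all other pairings of generators being zero. For $1\le i<j\le n+1$ put $E_{ji}:=[E_{j-1},[E_{j-2},[\cdots[E_{i+1},E_i]_{q^{-1}}\cdots]_{q^{-1}}]_{q^{-1}}$ (with $E_{i+1,i}=E_i$), $T^{(0,1)}:=\mathrm{span}_{\mathbb C}\{E_{ji}\}$, $A^+=\ker\varepsilon$, and $I:=\{x\in A^+\mid\langle X,x\rangle=0\ \forall X\in T^{(0,1)}\}$, a right ideal of $A$. Square brackets denote cosets in $A^+/I$; the elements $[u_{ji}]$, $i<j$, form the basis of $A^+/I$ dual to $\{E_{ji}\}$. *)

theory Defs
  imports
    "HOL-Algebra.QuotRing"
    "HOL-Algebra.Module"
    "HOL-Library.Poly_Mapping"
    "HOL-Library.Product_Plus"
    "HOL-Combinatorics.Permutations"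
    Complex_Main
begin

section \<open>Free algebras over the complex numbers\<close>

text \<open>
  Words over an alphabet form a monoid under concatenation, so that \<open>'g list \<Rightarrow>\<^sub>0 complex\<close>,
  with the multiplication of \<open>Poly_Mapping\<close>, is the free complex algebra on \<open>'g\<close>, and
  \<open>('g list \<times> 'g list) \<Rightarrow>\<^sub>0 complex\<close> is its tensor square as an algebra.
\<close>

instantiation list :: (type) monoid_add
begin
definition zero_list_def: "(0 :: 'a list) = []"
definition plus_list_def: "(xs :: 'a list) + ys = xs @ ys"
instance by standard (simp_all add: zero_list_def plus_list_def)
end

type_synonym 'g falg = "'g list \<Rightarrow>\<^sub>0 complex"
type_synonym 'g ftens = "('g list \<times> 'g list) \<Rightarrow>\<^sub>0 complex"

definition const :: "complex \<Rightarrow> ('m::zero \<Rightarrow>\<^sub>0 complex)" where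
  "const c = Poly_Mapping.single 0 c"

definition word :: "'g list \<Rightarrow> 'g falg" where
  "word w = Poly_Mapping.single w 1"

definition gen :: "'g \<Rightarrow> 'g falg" where
  "gen g = word [g]"

definition tens :: "'g list \<Rightarrow> 'g list \<Rightarrow> 'g ftens" where
  "tens v w = Poly_Mapping.single (v, w) 1"

definition free_alg :: "'g set \<Rightarrow> (complex, 'g falg) module" where
  "free_alg X =
    \<lparr>carrier = {p. Poly_Mapping.keys p \<subseteq> lists X}, monoid.mult = (*), one = 1, zero = 0, add = (+),
     smult = (\<lambda>c p. const c * p)\<rparr>"

text \<open>
  The unital algebra homomorphism extending \<open>\<phi>\<close> from the generators; \<open>\<iota>\<close> embeds the scalars
  into the target algebra.
\<close>

definition free_lift ::
    "(complex \<Rightarrow> 'b::ring_1) \<Rightarrow> ('g \<Rightarrow> 'b) \<Rightarrow> 'g falg \<Rightarrow> 'b" where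
  "free_lift \<iota> \<phi> p =
    (\<Sum>w\<in>Poly_Mapping.keys p. \<iota> (Poly_Mapping.lookup p w) * prod_list (map \<phi> w))"

section \<open>Presented algebras\<close>

definition quot_alg ::
    "(complex, 'a, 'm) module_scheme \<Rightarrow> 'a set \<Rightarrow> (complex, 'a set) module" where
  "quot_alg F J = ring.extend (F Quot J)
    (module.fields (\<lambda>c X. \<Union>x\<in>X. J +>\<^bsub>F\<^esub> (c \<odot>\<^bsub>F\<^esub> x)))"

definition rel_ideal :: "'g set \<Rightarrow> 'g falg set \<Rightarrow> 'g falg set" where
  "rel_ideal X R = Idl\<^bsub>free_alg X\<^esub> R"

definition presented_alg :: "'g set \<Rightarrow> 'g falg set \<Rightarrow> (complex, 'g falg set) module" where
  "presented_alg X R = quot_alg (free_alg X) (rel_ideal X R)"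

definition cls :: "'g set \<Rightarrow> 'g falg set \<Rightarrow> 'g falg \<Rightarrow> 'g falg set" where
  "cls X R p = rel_ideal X R +>\<^bsub>free_alg X\<^esub> p"

section \<open>The Drinfeld--Jimbo algebra $U_q(\mathfrak{sl}_{n+1})$\<close>

text \<open>\<open>L i\<close> is the generator $K_i^{-1}$.\<close>

datatype ugen = E nat | F nat | K nat | L nat

definition U_gens :: "nat \<Rightarrow> ugen set" where
  "U_gens n = E ` {1..n} \<union> F ` {1..n} \<union> K ` {1..n} \<union> L ` {1..n}"

definition cartan :: "nat \<Rightarrow> nat \<Rightarrow> int" where
  "cartan i j = (if i = j then 2 else if i = Suc j \<or> j = Suc i then -1 else 0)"

definition cq :: "real \<Rightarrow> int \<Rightarrow> complex" where
  "cq q k = complex_of_real q powi k"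

definition serre :: "real \<Rightarrow> (nat \<Rightarrow> ugen) \<Rightarrow> nat \<Rightarrow> nat \<Rightarrow> ugen falg" where
  "serre q X i j =
    (if i = Suc j \<or> j = Suc i
     then word [X i, X i, X j] - const (cq q 1 + cq q (-1)) * word [X i, X j, X i]
          + word [X j, X i, X i]
     else word [X i, X j] - word [X j, X i])"

definition U_rels :: "nat \<Rightarrow> real \<Rightarrow> ugen falg set" where
  "U_rels n q =
     {word [K i, L i] - 1 | i. i \<in> {1..n}}
   \<union> {word [L i, K i] - 1 | i. i \<in> {1..n}}
   \<union> {word [K i, K j] - word [K j, K i] | i j. i \<in> {1..n} \<and> j \<in> {1..n}}
   \<union> {word [K i, E j] - const (cq q (cartan i j)) * word [E j, K i]
        | i j. i \<in> {1..n} \<and> j \<in> {1..n}}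
   \<union> {word [K i, F j] - const (cq q (- cartan i j)) * word [F j, K i]
        | i j. i \<in> {1..n} \<and> j \<in> {1..n}}
   \<union> {word [E i, F j] - word [F j, E i]
        - (if i = j then const (1 / (cq q 1 - cq q (-1))) * (gen (K i) - gen (L i)) else 0)
        | i j. i \<in> {1..n} \<and> j \<in> {1..n}}
   \<union> {serre q X i j | X i j. X \<in> {E, F} \<and> i \<in> {1..n} \<and> j \<in> {1..n} \<and> i \<noteq> j}"

definition Uq :: "nat \<Rightarrow> real \<Rightarrow> (complex, ugen falg set) module" where
  "Uq n q = presented_alg (U_gens n) (U_rels n q)"

definition U_cls :: "nat \<Rightarrow> real \<Rightarrow> ugen falg \<Rightarrow> ugen falg set" where
  "U_cls n q = cls (U_gens n) (U_rels n q)"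

text \<open>
  Counit and coproduct on the free algebra. The relations span a biideal, so these induce the
  counit and coproduct of the quotient, computed on any representative.
\<close>

fun U_counit_gen :: "ugen \<Rightarrow> complex" where
  "U_counit_gen (E i) = 0"
| "U_counit_gen (F i) = 0"
| "U_counit_gen (K i) = 1"
| "U_counit_gen (L i) = 1"

fun U_coprod_gen :: "ugen \<Rightarrow> ugen ftens" where
  "U_coprod_gen (E i) = tens [E i] [K i] + tens [] [E i]"
| "U_coprod_gen (F i) = tens [F i] [] + tens [L i] [F i]"
| "U_coprod_gen (K i) = tens [K i] [K i]"
| "U_coprod_gen (L i) = tens [L i] [L i]"

definition U_counit :: "ugen falg set \<Rightarrow> complex" where
  "U_counit X = the_elem (free_lift id U_counit_gen ` X)"

definition U_coprod :: "ugen falg \<Rightarrow> ugen ftens" where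
  "U_coprod = free_lift const U_coprod_gen"

section \<open>The quantized function algebra $\mathcal{O}_q(\mathrm{SU}_{n+1})$\<close>

text \<open>The pair \<open>(i, j)\<close> stands for the generator $u_{ij}$.\<close>

type_synonym ogen = "nat \<times> nat"

definition O_gens :: "nat \<Rightarrow> ogen set" where
  "O_gens n = {1..n+1} \<times> {1..n+1}"

definition inversions :: "nat \<Rightarrow> (nat \<Rightarrow> nat) \<Rightarrow> nat" where
  "inversions n \<sigma> = card {(a, b). a \<in> {1..n+1} \<and> b \<in> {1..n+1} \<and> a < b \<and> \<sigma> b < \<sigma> a}"

definition qdet :: "nat \<Rightarrow> real \<Rightarrow> ogen falg" where
  "qdet n q = (\<Sum>\<sigma> | \<sigma> permutes {1..n+1}.
     const ((- complex_of_real q) ^ inversions n \<sigma>) * word (map (\<lambda>k. (k, \<sigma> k)) [1..<n+2]))"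

definition O_rels :: "nat \<Rightarrow> real \<Rightarrow> ogen falg set" where
  "O_rels n q =
     {word [(i, j), (i', j)] - const (cq q 1) * word [(i', j), (i, j)]
        | i i' j. {i, i', j} \<subseteq> {1..n+1} \<and> i < i'}
   \<union> {word [(i, j), (i, j')] - const (cq q 1) * word [(i, j'), (i, j)]
        | i j j'. {i, j, j'} \<subseteq> {1..n+1} \<and> j < j'}
   \<union> {word [(i, j'), (i', j)] - word [(i', j), (i, j')]
        | i i' j j'. {i, i', j, j'} \<subseteq> {1..n+1} \<and> i < i' \<and> j < j'}
   \<union> {word [(i, j), (i', j')] - word [(i', j'), (i, j)]
        - const (cq q 1 - cq q (-1)) * word [(i, j'), (i', j)]
        | i i' j j'. {i, i', j, j'} \<subseteq> {1..n+1} \<and> i < i' \<and> j < j'}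
   \<union> {qdet n q - 1}"

definition Oq :: "nat \<Rightarrow> real \<Rightarrow> (complex, ogen falg set) module" where
  "Oq n q = presented_alg (O_gens n) (O_rels n q)"

definition O_cls :: "nat \<Rightarrow> real \<Rightarrow> ogen falg \<Rightarrow> ogen falg set" where
  "O_cls n q = cls (O_gens n) (O_rels n q)"

definition u :: "nat \<Rightarrow> real \<Rightarrow> nat \<Rightarrow> nat \<Rightarrow> ogen falg set" where
  "u n q i j = O_cls n q (gen (i, j))"

definition O_counit :: "ogen falg set \<Rightarrow> complex" where
  "O_counit a = the_elem (free_lift id (\<lambda>(i, j). if i = j then 1 else 0) ` a)"

definition O_coprod :: "nat \<Rightarrow> ogen falg \<Rightarrow> ogen ftens" where
  "O_coprod n = free_lift const (\<lambda>(i, j). \<Sum>k\<in>{1..n+1}. tens [(i, k)] [(k, j)])"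

definition O_plus :: "nat \<Rightarrow> real \<Rightarrow> ogen falg set set" where
  "O_plus n q = {a \<in> carrier (Oq n q). O_counit a = 0}"

section \<open>The evaluation pairing\<close>

definition sweedler_sum :: "'g ftens \<Rightarrow> ('g list \<Rightarrow> 'g list \<Rightarrow> complex) \<Rightarrow> complex" where
  "sweedler_sum t f = (\<Sum>(v, w)\<in>Poly_Mapping.keys t. Poly_Mapping.lookup t (v, w) * f v w)"

fun gen_pairing :: "real \<Rightarrow> ugen \<Rightarrow> ogen \<Rightarrow> complex" where
  "gen_pairing q (E k) (i, j) = (if i = k + 1 \<and> j = k then 1 else 0)"
| "gen_pairing q (F k) (i, j) = (if i = k \<and> j = k + 1 then 1 else 0)"
| "gen_pairing q (K k) (i, j) =
     (if i = j then cq q (of_bool (k + 1 = i) - of_bool (i = k)) else 0)"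
| "gen_pairing q (L k) (i, j) =
     (if i = j then cq q (- (of_bool (k + 1 = i) - of_bool (i = k))) else 0)"

text \<open>
  \<open>P\<close> is a dual pairing of bialgebras with the given values on generators. Its values on
  the carriers are uniquely determined by these conditions; outside them \<open>P\<close> is unconstrained.
  The two Sweedler conditions are
  $\langle X, ab\rangle = \langle X_{(1)}, a\rangle\langle X_{(2)}, b\rangle$ and
  $\langle XY, a\rangle = \langle X, a_{(1)}\rangle\langle Y, a_{(2)}\rangle$.
\<close>

definition evaluation_pairing ::
    "nat \<Rightarrow> real \<Rightarrow> (ugen falg set \<Rightarrow> ogen falg set \<Rightarrow> complex) \<Rightarrow> bool" where
  "evaluation_pairing n q P \<longleftrightarrow>
     (\<forall>X\<in>carrier (Uq n q). \<forall>Y\<in>carrier (Uq n q). \<forall>a\<in>carrier (Oq n q).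
        P (X \<oplus>\<^bsub>Uq n q\<^esub> Y) a = P X a + P Y a) \<and>
     (\<forall>X\<in>carrier (Uq n q). \<forall>a\<in>carrier (Oq n q). \<forall>b\<in>carrier (Oq n q).
        P X (a \<oplus>\<^bsub>Oq n q\<^esub> b) = P X a + P X b) \<and>
     (\<forall>c. \<forall>X\<in>carrier (Uq n q). \<forall>a\<in>carrier (Oq n q).
        P (c \<odot>\<^bsub>Uq n q\<^esub> X) a = c * P X a \<and> P X (c \<odot>\<^bsub>Oq n q\<^esub> a) = c * P X a) \<and>
     (\<forall>X\<in>carrier (Uq n q). P X \<one>\<^bsub>Oq n q\<^esub> = U_counit X) \<and>
     (\<forall>a\<in>carrier (Oq n q). P \<one>\<^bsub>Uq n q\<^esub> a = O_counit a) \<and>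
     (\<forall>x\<in>carrier (free_alg (U_gens n)). \<forall>a\<in>carrier (Oq n q). \<forall>b\<in>carrier (Oq n q).
        P (U_cls n q x) (a \<otimes>\<^bsub>Oq n q\<^esub> b) =
          sweedler_sum (U_coprod x)
            (\<lambda>v w. P (U_cls n q (word v)) a * P (U_cls n q (word w)) b)) \<and>
     (\<forall>X\<in>carrier (Uq n q). \<forall>Y\<in>carrier (Uq n q). \<forall>y\<in>carrier (free_alg (O_gens n)).
        P (X \<otimes>\<^bsub>Uq n q\<^esub> Y) (O_cls n q y) =
          sweedler_sum (O_coprod n y)
            (\<lambda>v w. P X (O_cls n q (word v)) * P Y (O_cls n q (word w)))) \<and>
     (\<forall>x\<in>U_gens n. \<forall>(i, j)\<in>O_gens n.
        P (U_cls n q (gen x)) (u n q i j) = gen_pairing q x (i, j))"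

section \<open>The tangent space and the right ideal\<close>

definition pos_roots :: "nat \<Rightarrow> (nat \<times> nat) set" where
  "pos_roots n = {(i, j). 1 \<le> i \<and> i < j \<and> j \<le> n + 1}"

definition qcomm :: "(complex, 'a, 'm) module_scheme \<Rightarrow> complex \<Rightarrow> 'a \<Rightarrow> 'a \<Rightarrow> 'a" where
  "qcomm R c a b = (a \<otimes>\<^bsub>R\<^esub> b) \<ominus>\<^bsub>R\<^esub> (c \<odot>\<^bsub>R\<^esub> (b \<otimes>\<^bsub>R\<^esub> a))"

text \<open>\<open>root_vec n q j i\<close> is $E_{ji}$; its value is meaningful for $i < j$ only.\<close>

primrec root_vec :: "nat \<Rightarrow> real \<Rightarrow> nat \<Rightarrow> nat \<Rightarrow> ugen falg set" where
  "root_vec n q 0 i = \<zero>\<^bsub>Uq n q\<^esub>"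
| "root_vec n q (Suc j) i =
     (if j = i then U_cls n q (gen (E i))
      else qcomm (Uq n q) (cq q (-1)) (U_cls n q (gen (E j))) (root_vec n q j i))"

definition T01 :: "nat \<Rightarrow> real \<Rightarrow> ugen falg set set" where
  "T01 n q = {(\<Oplus>\<^bsub>Uq n q\<^esub>p\<in>pos_roots n. c p \<odot>\<^bsub>Uq n q\<^esub> root_vec n q (snd p) (fst p))
               | c. True}"

definition I01 ::
    "nat \<Rightarrow> real \<Rightarrow> (ugen falg set \<Rightarrow> ogen falg set \<Rightarrow> complex) \<Rightarrow> ogen falg set set" where
  "I01 n q P = {x \<in> O_plus n q. \<forall>X\<in>T01 n q. P X x = 0}"

definition right_ideal :: "'a set \<Rightarrow> ('a, 'm) ring_scheme \<Rightarrow> bool" where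
  "right_ideal I R \<longleftrightarrow>
     additive_subgroup I R \<and> (\<forall>a\<in>I. \<forall>x\<in>carrier R. a \<otimes>\<^bsub>R\<^esub> x \<in> I)"

definition gen_right_ideal :: "('a, 'm) ring_scheme \<Rightarrow> 'a set \<Rightarrow> 'a set" where
  "gen_right_ideal R S = \<Inter>{I. right_ideal I R \<and> S \<subseteq> I}"

section \<open>The right module $\Lambda^{(0,1)}_q = A^+/I$\<close>

text \<open>
  Elements are the cosets of \<open>I\<close> inside \<open>A\<^sup>+\<close>. The fields \<open>mult\<close> and \<open>one\<close> of the record have
  no meaning for a module.
\<close>

definition Lam_cls :: "nat \<Rightarrow> real \<Rightarrow> (ugen falg set \<Rightarrow> ogen falg set \<Rightarrow> complex) \<Rightarrow>
    ogen falg set \<Rightarrow> ogen falg set set" where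
  "Lam_cls n q P x = I01 n q P +>\<^bsub>Oq n q\<^esub> x"

definition Lam :: "nat \<Rightarrow> real \<Rightarrow> (ugen falg set \<Rightarrow> ogen falg set \<Rightarrow> complex) \<Rightarrow>
    (complex, ogen falg set set) module" where
  "Lam n q P =
    \<lparr>carrier = Lam_cls n q P ` O_plus n q, monoid.mult = undefined, one = undefined,
     zero = I01 n q P, add = set_add (Oq n q),
     smult = (\<lambda>c M. \<Union>x\<in>M. Lam_cls n q P (c \<odot>\<^bsub>Oq n q\<^esub> x))\<rparr>"

definition Lam_act :: "nat \<Rightarrow> real \<Rightarrow> (ugen falg set \<Rightarrow> ogen falg set \<Rightarrow> complex) \<Rightarrow>
    ogen falg set set \<Rightarrow> ogen falg set \<Rightarrow> ogen falg set set" where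
  "Lam_act n q P M a = (\<Union>x\<in>M. Lam_cls n q P (x \<otimes>\<^bsub>Oq n q\<^esub> a))"

definition e01 :: "nat \<Rightarrow> real \<Rightarrow> (ugen falg set \<Rightarrow> ogen falg set \<Rightarrow> complex) \<Rightarrow>
    nat \<Rightarrow> nat \<Rightarrow> ogen falg set set" where
  "e01 n q P j i = Lam_cls n q P (u n q j i)"

definition Lam_basis :: "nat \<Rightarrow> real \<Rightarrow> (ugen falg set \<Rightarrow> ogen falg set \<Rightarrow> complex) \<Rightarrow> bool" where
  "Lam_basis n q P \<longleftrightarrow>
     (\<forall>(i, j)\<in>pos_roots n. e01 n q P j i \<in> carrier (Lam n q P)) \<and>
     (\<forall>M\<in>carrier (Lam n q P). \<exists>!c. c \<in> pos_roots n \<rightarrow>\<^sub>E UNIV \<and>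
        M = (\<Oplus>\<^bsub>Lam n q P\<^esub>p\<in>pos_roots n. c p \<odot>\<^bsub>Lam n q P\<^esub> e01 n q P (snd p) (fst p)))"

definition G1 :: "nat \<Rightarrow> real \<Rightarrow> ogen falg set set" where
  "G1 n q = {u n q i j | i j. (i, j) \<in> pos_roots n}
          \<union> {u n q k k \<ominus>\<^bsub>Oq n q\<^esub> \<one>\<^bsub>Oq n q\<^esub> | k. k \<in> {1..n+1}}"

definition G2 :: "nat \<Rightarrow> real \<Rightarrow> ogen falg set set" where
  "G2 n q = {u n q j i \<otimes>\<^bsub>Oq n q\<^esub> u n q k l
              | i j k l. (i, j) \<in> pos_roots n \<and> (k, l) \<in> pos_roots n}"

definition G3 :: "nat \<Rightarrow> real \<Rightarrow> ogen falg set set" where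
  "G3 n q = {u n q j i \<otimes>\<^bsub>Oq n q\<^esub> u n q l k
              | i j k l. (i, j) \<in> pos_roots n \<and> (k, l) \<in> pos_roots n \<and> j \<noteq> k}"

end

theory Submission
  imports Defs
begin

text \<open>
  Write $f_{ji}(p) = \langle E_{ji}, p\rangle$ and $\varepsilon(p) = \langle 1, p\rangle$. Everything
  follows from one twisted Leibniz rule, \<open>pr_root_snoc\<close>:
  $$f_{ji}(p\,u_{kl}) = \delta_{kl}\, q^{\delta_{jk}-\delta_{ik}} f_{ji}(p)
     + \delta_{kj}\delta_{li}\, \varepsilon(p) + [k = j,\ i < l < j]\, \nu\, f_{li}(p).$$
  It is proved on words (\<open>root_word_snoc\<close>) by induction on $j$ along
  $E_{j+1,i} = E_j E_{ji} - q^{-1} E_{ji} E_j$: a product in $U_q$ pairs with $p\,u_{kl}$ through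
  $\Delta(u_{kl}) = \sum_m u_{km} \otimes u_{ml}$, and the unwanted terms cancel because $E_j$
  commutes with $E_{li}$ for $l < j$ (\<open>root_rep_commute\<close>).

  The rule shows that the right-hand sides vanish when $\varepsilon$ and all $f_{ji}$ vanish at $p$, so
  $I$ is a right ideal. It also gives $f_{ji}(u_{kl}) = \delta_{kj}\delta_{li}$, so that every $p$ is
  congruent modulo $I$ to its linear part $\varepsilon(p) + \sum f_{ji}(p)\, u_{ji}$. Hence the classes
  $[u_{ji}]$ form a basis of $A^+/I$, and the action of $u_{kl}$ on $[u_{ji}]$ is read off from the
  linear part of $u_{ji}u_{kl}$ (\<open>linear_part_gen_gen\<close>).

  For generation, let $J$ be any right ideal containing $G$ and consider those $p$ whose difference
  from their linear part lies in $J$ (\<open>I01_least\<close>). They form a subspace containing $1$; if $p$ is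
  one of them, then $p\,u_{kl}$ is the sum of an element of $J \cap I$ and of a linear combination
  of $u_{kl}$ and the products $u_{ji}u_{kl}$. The quadratic relations reduce each such product to its
  linear part modulo $J$, so the subspace is all of $A$. On $I$ the linear part vanishes, whence
  $I \subseteq J$.

  The computations take place in the free algebras, where ordinary ring arithmetic is available, and are
  carried to the presented algebras by the class map.
\<close>

section \<open>Presented algebras and their class map\<close>

lemma free_alg_simps [simp]:
  "monoid.mult (free_alg X) = (*)" "one (free_alg X) = 1" "zero (free_alg X) = 0"
  "add (free_alg X) = (+)" "smult (free_alg X) = (\<lambda>c p. const c * p)"
  by (simp_all add: free_alg_def)

lemma in_free_alg: "p \<in> carrier (free_alg X) \<longleftrightarrow> Poly_Mapping.keys p \<subseteq> lists X"
  by (simp add: free_alg_def)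

lemma word_in_free_alg: "w \<in> lists X \<Longrightarrow> word w \<in> carrier (free_alg X)"
  by (simp add: in_free_alg word_def)

lemma gen_in_free_alg: "g \<in> X \<Longrightarrow> gen g \<in> carrier (free_alg X)"
  by (simp add: gen_def word_in_free_alg)

lemma const_in_free_alg: "const c \<in> carrier (free_alg X)"
  by (simp add: in_free_alg const_def zero_list_def)

lemma zero_in_free_alg: "0 \<in> carrier (free_alg X)"
  and one_in_free_alg: "1 \<in> carrier (free_alg X)"
  by (simp_all add: in_free_alg zero_list_def)

lemma add_in_free_alg:
  "p \<in> carrier (free_alg X) \<Longrightarrow> r \<in> carrier (free_alg X) \<Longrightarrow> p + r \<in> carrier (free_alg X)"
  unfolding in_free_alg by (meson Poly_Mapping.keys_add Un_least order_trans)

lemma mult_in_free_alg: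
  assumes "p \<in> carrier (free_alg X)" "r \<in> carrier (free_alg X)"
  shows "p * r \<in> carrier (free_alg X)"
  using assms Poly_Mapping.keys_mult[of p r] unfolding in_free_alg plus_list_def
  by fastforce

lemma uminus_in_free_alg: "p \<in> carrier (free_alg X) \<Longrightarrow> - p \<in> carrier (free_alg X)"
  by (simp add: in_free_alg in_keys_iff subset_iff)

lemma diff_in_free_alg:
  "p \<in> carrier (free_alg X) \<Longrightarrow> r \<in> carrier (free_alg X) \<Longrightarrow> p - r \<in> carrier (free_alg X)"
  using add_in_free_alg[of p X "- r"] uminus_in_free_alg by auto

lemma sum_in_free_alg:
  "(\<And>a. a \<in> A \<Longrightarrow> f a \<in> carrier (free_alg X)) \<Longrightarrow> sum f A \<in> carrier (free_alg X)"
  by (induction A rule: infinite_finite_induct) (auto intro: add_in_free_alg zero_in_free_alg)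

lemmas free_alg_closed = word_in_free_alg gen_in_free_alg const_in_free_alg zero_in_free_alg
  one_in_free_alg add_in_free_alg mult_in_free_alg uminus_in_free_alg diff_in_free_alg
  sum_in_free_alg

lemma word_append: "word (v @ w) = word v * word w"
  by (simp add: word_def mult_single plus_list_def)

lemma word_Nil: "word [] = 1"
  by (metis single_one word_def zero_list_def)

lemma const_zero [simp]: "const 0 = 0"
  and const_one [simp]: "const 1 = 1"
  by (simp_all add: const_def)

lemma const_mult: "const (c * d) = const c * const d"
  and const_add: "const (c + d) = const c + const d"
  and const_uminus: "const (- c) = - const c"
  by (simp_all add: const_def mult_single single_add single_uminus)

lemma free_alg_as_sum:
  "p = (\<Sum>w\<in>Poly_Mapping.keys p. const (Poly_Mapping.lookup p w) * word w)"
proof (rule poly_mapping_eqI)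
  fix v
  have "(\<Sum>w\<in>Poly_Mapping.keys p. Poly_Mapping.lookup (const (Poly_Mapping.lookup p w) * word w) v)
    = (\<Sum>w\<in>Poly_Mapping.keys p. if w = v then Poly_Mapping.lookup p v else 0)"
    by (rule sum.cong) (auto simp: const_def word_def mult_single lookup_single zero_list_def plus_list_def)
  also have "\<dots> = Poly_Mapping.lookup p v"
    by (simp add: in_keys_iff)
  finally show "Poly_Mapping.lookup p v =
    Poly_Mapping.lookup (\<Sum>w\<in>Poly_Mapping.keys p. const (Poly_Mapping.lookup p w) * word w) v"
    by (simp add: lookup_sum)
qed

lemma const_commute: "const c * p = (p :: 'g falg) * const c"
proof -
  have *: "const c * (const d * word w) = (const d * word w) * const c" for d and w :: "'g list"
    by (simp add: const_def word_def mult_single mult.commute zero_list_def plus_list_def)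
  show ?thesis
    by (subst (1 2) free_alg_as_sum) (simp only: sum_distrib_left sum_distrib_right *)
qed

lemma free_alg_word_induct [consumes 1, case_names add smult word]:
  assumes p: "p \<in> carrier (free_alg X)"
    and add: "\<And>p r. p \<in> carrier (free_alg X) \<Longrightarrow> r \<in> carrier (free_alg X) \<Longrightarrow> Q p \<Longrightarrow> Q r \<Longrightarrow> Q (p + r)"
    and smult: "\<And>c p. p \<in> carrier (free_alg X) \<Longrightarrow> Q p \<Longrightarrow> Q (const c * p)"
    and word: "\<And>w. w \<in> lists X \<Longrightarrow> Q (word w)"
  shows "Q p"
proof -
  have zero: "Q 0" using smult[of "word []" 0] word[of "[]"] word_in_free_alg[of "[]" X] by simp
  have "Q (\<Sum>w\<in>A. const (Poly_Mapping.lookup p w) * word w)"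
    if "finite A" "A \<subseteq> lists X" for A
    using that
  proof (induction A rule: finite_induct)
    case (insert w A)
    then show ?case
      by (simp, intro add smult word free_alg_closed) (auto intro: free_alg_closed)
  qed (simp add: zero)
  then show ?thesis
    using p free_alg_as_sum[of p] unfolding in_free_alg by (metis finite_keys)
qed

lemma free_alg_induct [consumes 1, case_names add smult one snoc]:
  assumes "p \<in> carrier (free_alg X)"
    and "\<And>p r. p \<in> carrier (free_alg X) \<Longrightarrow> r \<in> carrier (free_alg X) \<Longrightarrow> Q p \<Longrightarrow> Q r \<Longrightarrow> Q (p + r)"
    and "\<And>c p. p \<in> carrier (free_alg X) \<Longrightarrow> Q p \<Longrightarrow> Q (const c * p)"
    and one: "Q 1"
    and snoc: "\<And>p g. p \<in> carrier (free_alg X) \<Longrightarrow> g \<in> X \<Longrightarrow> Q p \<Longrightarrow> Q (p * gen g)"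
  shows "Q p"
  using assms(1-3)
proof (induction p rule: free_alg_word_induct)
  case (word w)
  then show ?case
  proof (induction w rule: rev_induct)
    case (snoc g w)
    then show ?case
      using assms(5)[of "word w" g] by (simp add: word_append gen_def free_alg_closed)
  qed (simp add: one word_Nil)
qed auto

lemma free_alg_ring: "ring (free_alg X)"
proof (rule ringI)
  show "abelian_group (free_alg X)"
  proof (rule abelian_groupI)
    fix p assume "p \<in> carrier (free_alg X)"
    then show "\<exists>y\<in>carrier (free_alg X). y \<oplus>\<^bsub>free_alg X\<^esub> p = \<zero>\<^bsub>free_alg X\<^esub>"
      by (intro bexI[of _ "- p"]) (auto intro: free_alg_closed)
  qed (auto intro: free_alg_closed simp: algebra_simps)
  show "Group.monoid (free_alg X)"
    by (rule monoidI) (auto intro: free_alg_closed simp: algebra_simps)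
qed (auto simp: algebra_simps)

lemma free_alg_minus:
  assumes "p \<in> carrier (free_alg X)" "r \<in> carrier (free_alg X)"
  shows "p \<ominus>\<^bsub>free_alg X\<^esub> r = p - r"
proof -
  interpret ring "free_alg X" by (rule free_alg_ring)
  have "\<ominus>\<^bsub>free_alg X\<^esub> r = - r"
    using minus_equality[of "- r" r] assms uminus_in_free_alg by auto
  then show ?thesis by (simp add: a_minus_def)
qed

lemma quot_alg_simps:
  "carrier (quot_alg B J) = carrier (B Quot J)" "monoid.mult (quot_alg B J) = monoid.mult (B Quot J)"
  "one (quot_alg B J) = one (B Quot J)" "zero (quot_alg B J) = zero (B Quot J)"
  "add (quot_alg B J) = add (B Quot J)"
  "smult (quot_alg B J) = (\<lambda>c X. \<Union>x\<in>X. J +>\<^bsub>B\<^esub> (c \<odot>\<^bsub>B\<^esub> x))"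
  by (simp_all add: quot_alg_def ring.defs module.defs)

text \<open>The ring axioms mention only the ring fields of a record, so they survive the addition of a
  scalar multiplication.\<close>

lemma ring_cong:
  fixes R :: "('a, 'm) ring_scheme" and S :: "('a, 'k) ring_scheme"
  assumes R: "ring R" and S: "carrier S = carrier R" "monoid.mult S = monoid.mult R" "one S = one R"
    "zero S = zero R" "add S = add R"
  shows "ring S"
proof -
  interpret ring R by (rule R)
  show ?thesis
  proof (rule ringI)
    show "abelian_group S"
      by (rule abelian_groupI) (auto simp: S a_assoc a_comm a_lcomm intro: l_neg a_inv_closed)
    show "Group.monoid S"
      by (rule monoidI) (auto simp: S m_assoc)
  qed (auto simp: S l_distr r_distr)
qed

locale presentation =
  fixes X :: "'g set" and R :: "'g falg set"
  assumes rels: "R \<subseteq> carrier (free_alg X)"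
begin

sublocale free: ring "free_alg X"
  by (rule free_alg_ring)

sublocale relI: ideal "rel_ideal X R" "free_alg X"
  unfolding rel_ideal_def by (rule free.genideal_ideal[OF rels])

sublocale pres: ring "presented_alg X R"
  unfolding presented_alg_def
  by (rule ring_cong[OF relI.quotient_is_ring]) (simp_all add: quot_alg_simps)

lemma carrier_presented: "carrier (presented_alg X R) = cls X R ` carrier (free_alg X)"
  by (auto simp: presented_alg_def quot_alg_simps FactRing_def A_RCOSETS_def' cls_def)

lemma cls_add:
  assumes "p \<in> carrier (free_alg X)" "r \<in> carrier (free_alg X)"
  shows "cls X R (p + r) = cls X R p \<oplus>\<^bsub>presented_alg X R\<^esub> cls X R r"
  using relI.a_rcos_sum[OF assms]
  by (simp add: presented_alg_def quot_alg_simps cls_def FactRing_def)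

lemma cls_mult:
  assumes "p \<in> carrier (free_alg X)" "r \<in> carrier (free_alg X)"
  shows "cls X R (p * r) = cls X R p \<otimes>\<^bsub>presented_alg X R\<^esub> cls X R r"
  using relI.rcoset_mult_add[OF assms]
  by (simp add: presented_alg_def quot_alg_simps cls_def FactRing_def)

lemma cls_one: "cls X R 1 = \<one>\<^bsub>presented_alg X R\<^esub>"
  by (simp add: presented_alg_def quot_alg_simps cls_def FactRing_def)

lemma cls_closed: "p \<in> carrier (free_alg X) \<Longrightarrow> cls X R p \<in> carrier (presented_alg X R)"
  by (simp add: carrier_presented)

lemma cls_zero: "cls X R 0 = \<zero>\<^bsub>presented_alg X R\<^esub>"
  using relI.a_rcos_const[OF relI.zero_closed]
  by (simp add: presented_alg_def quot_alg_simps cls_def FactRing_def)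

lemma cls_eqI:
  assumes "p - r \<in> R" "p \<in> carrier (free_alg X)" "r \<in> carrier (free_alg X)"
  shows "cls X R p = cls X R r"
proof -
  have "p - r \<in> rel_ideal X R"
    unfolding rel_ideal_def using free.genideal_self[OF rels] assms(1) by auto
  then have "cls X R (p - r) = \<zero>\<^bsub>presented_alg X R\<^esub>"
    using relI.a_rcos_const by (simp add: presented_alg_def quot_alg_simps cls_def FactRing_def)
  then show ?thesis
    using cls_add[of "p - r" r] assms cls_closed by (simp add: diff_in_free_alg)
qed

text \<open>The scalar multiple of a coset is a union over all its representatives. They all give the same
  coset because the relations generate a subspace.\<close>

lemma cls_smult:
  assumes p: "p \<in> carrier (free_alg X)"
  shows "cls X R (const c * p) = c \<odot>\<^bsub>presented_alg X R\<^esub> cls X R p"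
proof -
  have "rel_ideal X R +>\<^bsub>free_alg X\<^esub> (const c * x) = cls X R (const c * p)" if x: "x \<in> cls X R p" for x
  proof -
    have xc: "x \<in> carrier (free_alg X)" and "x - p \<in> rel_ideal X R"
      using x relI.a_rcos_module_minus[OF free_alg_ring p, of x] relI.a_elemrcos_carrier[OF p]
      by (auto simp: cls_def free_alg_minus p)
    then have "const c * (x - p) \<in> rel_ideal X R"
      using relI.I_l_closed[of "x - p" "const c"] const_in_free_alg by auto
    then have "const c * x - const c * p \<in> rel_ideal X R" by (simp add: algebra_simps)
    then have "const c * x \<in> rel_ideal X R +>\<^bsub>free_alg X\<^esub> (const c * p)"
      using xc p relI.a_rcos_module_minus[OF free_alg_ring, of "const c * p" "const c * x"]
      by (simp add: free_alg_minus free_alg_closed)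
    then show ?thesis
      unfolding cls_def using xc p relI.a_repr_independence'[symmetric] by (simp add: free_alg_closed)
  qed
  moreover have "p \<in> cls X R p" unfolding cls_def by (rule relI.a_rcos_self[OF p])
  ultimately show ?thesis
    unfolding presented_alg_def quot_alg_simps by auto
qed

lemma cls_diff:
  assumes "p \<in> carrier (free_alg X)" "r \<in> carrier (free_alg X)"
  shows "cls X R (p - r) = cls X R p \<ominus>\<^bsub>presented_alg X R\<^esub> cls X R r"
proof -
  have "cls X R p = cls X R (p - r) \<oplus>\<^bsub>presented_alg X R\<^esub> cls X R r"
    using assms by (simp flip: cls_add add: free_alg_closed)
  moreover have "cls X R (p - r) \<in> carrier (presented_alg X R)" "cls X R r \<in> carrier (presented_alg X R)"
    using assms by (auto intro!: cls_closed free_alg_closed)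
  ultimately show ?thesis
    by (simp add: pres.minus_eq pres.add.m_assoc pres.r_neg)
qed

lemma cls_uminus:
  assumes "p \<in> carrier (free_alg X)"
  shows "cls X R (- p) = \<ominus>\<^bsub>presented_alg X R\<^esub> cls X R p"
  using cls_diff[of 0 p] assms
  by (simp add: zero_in_free_alg cls_zero cls_closed pres.minus_eq)

lemma cls_sum:
  assumes "finite A" "\<And>a. a \<in> A \<Longrightarrow> f a \<in> carrier (free_alg X)"
  shows "cls X R (sum f A) = (\<Oplus>\<^bsub>presented_alg X R\<^esub>a\<in>A. cls X R (f a))"
  using assms
proof (induction A rule: finite_induct)
  case (insert a A)
  then show ?case
    by (subst pres.finsum_insert) (auto simp: cls_add sum_in_free_alg intro: cls_closed)
qed (simp add: cls_zero)

end

section \<open>Sweedler sums and convolution on words\<close>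

lemma free_lift_word:
  "free_lift \<iota> \<phi> (word w) = \<iota> 1 * prod_list (map \<phi> w)"
  by (simp add: free_lift_def word_def)

lemma sweedler_sum_superset:
  assumes "finite A" "Poly_Mapping.keys t \<subseteq> A"
  shows "sweedler_sum t f = (\<Sum>(v, w)\<in>A. Poly_Mapping.lookup t (v, w) * f v w)"
  unfolding sweedler_sum_def using assms
  by (intro sum.mono_neutral_left) (auto simp: in_keys_iff)

lemma sweedler_sum_zero [simp]: "sweedler_sum 0 f = 0"
  by (simp add: sweedler_sum_def)

lemma sweedler_sum_plus: "sweedler_sum (s + t) f = sweedler_sum s f + sweedler_sum t f"
proof -
  let ?A = "Poly_Mapping.keys s \<union> Poly_Mapping.keys t"
  have "Poly_Mapping.keys (s + t) \<subseteq> ?A" by (rule Poly_Mapping.keys_add)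
  then have "sweedler_sum (s + t) f = (\<Sum>(v, w)\<in>?A. Poly_Mapping.lookup (s + t) (v, w) * f v w)"
    by (intro sweedler_sum_superset) auto
  also have "\<dots> = (\<Sum>(v, w)\<in>?A. Poly_Mapping.lookup s (v, w) * f v w)
      + (\<Sum>(v, w)\<in>?A. Poly_Mapping.lookup t (v, w) * f v w)"
    by (simp add: lookup_add distrib_right sum.distrib case_prod_unfold)
  also have "\<dots> = sweedler_sum s f + sweedler_sum t f"
    by (subst (1 2) sweedler_sum_superset[of ?A]) auto
  finally show ?thesis .
qed

lemma sweedler_sum_single: "sweedler_sum (Poly_Mapping.single (v, w) c) f = c * f v w"
  by (simp add: sweedler_sum_def)

lemma sweedler_sum_tens [simp]: "sweedler_sum (tens v w) f = f v w"
  by (simp add: tens_def sweedler_sum_single)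

lemma sweedler_sum_sum: "sweedler_sum (sum t A) f = (\<Sum>a\<in>A. sweedler_sum (t a) f)"
  by (induction A rule: infinite_finite_induct) (simp_all add: sweedler_sum_plus)

lemma ftens_as_sum:
  "t = (\<Sum>x\<in>Poly_Mapping.keys t. Poly_Mapping.single x (Poly_Mapping.lookup t x))"
proof (rule poly_mapping_eqI)
  fix y
  have "(\<Sum>x\<in>Poly_Mapping.keys t. Poly_Mapping.lookup (Poly_Mapping.single x (Poly_Mapping.lookup t x)) y)
    = (\<Sum>x\<in>Poly_Mapping.keys t. if x = y then Poly_Mapping.lookup t y else 0)"
    by (rule sum.cong) (auto simp: lookup_single)
  then show "Poly_Mapping.lookup t y = Poly_Mapping.lookup
      (\<Sum>x\<in>Poly_Mapping.keys t. Poly_Mapping.single x (Poly_Mapping.lookup t x)) y"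
    by (simp add: lookup_sum in_keys_iff)
qed

lemma sweedler_sum_times_tens:
  "sweedler_sum (t * tens v' w') f = sweedler_sum t (\<lambda>v w. f (v @ v') (w @ w'))"
proof -
  have *: "sweedler_sum (Poly_Mapping.single x c * tens v' w') f
      = sweedler_sum (Poly_Mapping.single x c) (\<lambda>v w. f (v @ v') (w @ w'))" for x c
    by (cases x) (simp add: tens_def mult_single sweedler_sum_single plus_list_def)
  show ?thesis
    by (subst (1 2) ftens_as_sum) (simp only: sum_distrib_right sweedler_sum_sum *)
qed

text \<open>The product of two functionals in the dual of the bialgebra, evaluated on words.\<close>

definition conv :: "nat \<Rightarrow> (ogen list \<Rightarrow> complex) \<Rightarrow> (ogen list \<Rightarrow> complex) \<Rightarrow> ogen list \<Rightarrow> complex" where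
  "conv n a b w = sweedler_sum (O_coprod n (word w)) (\<lambda>v v'. a v * b v')"

lemma conv_Nil: "conv n a b [] = a [] * b []"
proof -
  have "(1 :: ogen ftens) = tens [] []"
    unfolding tens_def by (metis single_one zero_list_def zero_prod_def)
  then have "sweedler_sum (1 :: ogen ftens) f = f [] []" for f
    using sweedler_sum_tens by metis
  then show ?thesis
    by (simp add: conv_def O_coprod_def free_lift_word)
qed

text \<open>A matrix coefficient splits as $\Delta(u_{kl}) = \sum_m u_{km} \otimes u_{ml}$, so the last letter
  can be split off. This recursion and \<open>conv_Nil\<close> determine \<open>conv\<close> completely, and proofs about it go by
  induction on the word from its right end.\<close>

lemma conv_snoc:
  "conv n a b (w @ [(k, l)])
    = (\<Sum>m\<in>{1..n+1}. conv n (\<lambda>v. a (v @ [(k, m)])) (\<lambda>v. b (v @ [(m, l)])) w)"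
  unfolding conv_def O_coprod_def free_lift_word
  by (simp add: sum_distrib_left sweedler_sum_sum sweedler_sum_times_tens del: sum.cl_ivl_Suc)

lemma conv_singleton: "conv n a b [(k, l)] = (\<Sum>m\<in>{1..n+1}. a [(k, m)] * b [(m, l)])"
  using conv_snoc[of n a b "[]" k l] by (simp add: conv_Nil del: sum.cl_ivl_Suc)

text \<open>A pairing is controlled only on the classes of elements of the free algebra on the given
  generators, hence functionals can be exchanged only when they agree on words in these.\<close>

lemma conv_cong:
  assumes "w \<in> lists (O_gens n)"
    and "\<And>v. v \<in> lists (O_gens n) \<Longrightarrow> a v = a' v" "\<And>v. v \<in> lists (O_gens n) \<Longrightarrow> b v = b' v"
  shows "conv n a b w = conv n a' b' w"
  using assms
proof (induction w arbitrary: a a' b b' rule: rev_induct)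
  case (snoc x w)
  obtain k l where x: "x = (k, l)" by (cases x)
  show ?case
    unfolding x conv_snoc
    by (intro sum.cong refl snoc.IH) (use snoc.prems x in \<open>auto simp: O_gens_def\<close>)
qed (simp add: conv_Nil)

lemma conv_add_left: "conv n (\<lambda>v. a v + a' v) b w = conv n a b w + conv n a' b w"
  and conv_add_right: "conv n b (\<lambda>v. a v + a' v) w = conv n b a w + conv n b a' w"
  by (simp_all add: conv_def sweedler_sum_def case_prod_unfold algebra_simps sum.distrib)

lemma conv_scale_left: "conv n (\<lambda>v. c * a v) b w = c * conv n a b w"
  and conv_scale_right: "conv n b (\<lambda>v. c * a v) w = c * conv n b a w"
  by (simp_all add: conv_def sweedler_sum_def case_prod_unfold algebra_simps sum_distrib_left)

lemmas conv_linear = conv_add_left conv_add_right conv_scale_left conv_scale_right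

section \<open>The pairing on representatives\<close>

lemma cq_add: "q \<noteq> 0 \<Longrightarrow> cq q (a + b) = cq q a * cq q b"
  by (simp add: cq_def power_int_add)

lemma cq_nonzero: "q \<noteq> 0 \<Longrightarrow> cq q a \<noteq> 0"
  by (simp add: cq_def)

lemma cq_zero [simp]: "cq q 0 = 1"
  by (simp add: cq_def)

lemma U_gens_simps:
  "E i \<in> U_gens n \<longleftrightarrow> i \<in> {1..n}" "F i \<in> U_gens n \<longleftrightarrow> i \<in> {1..n}"
  "K i \<in> U_gens n \<longleftrightarrow> i \<in> {1..n}" "L i \<in> U_gens n \<longleftrightarrow> i \<in> {1..n}"
  by (auto simp: U_gens_def)

lemma serre_in_free_alg:
  "X i \<in> A \<Longrightarrow> X j \<in> A \<Longrightarrow> serre q X i j \<in> carrier (free_alg A)"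
  unfolding serre_def by (auto intro!: free_alg_closed)

lemma U_presentation: "presentation (U_gens n) (U_rels n q)"
proof
  show "U_rels n q \<subseteq> carrier (free_alg (U_gens n))"
    unfolding U_rels_def
    apply (intro Un_least; clarify)
          apply (intro free_alg_closed; simp add: U_gens_simps)
         apply (intro free_alg_closed; simp add: U_gens_simps)
        apply (intro free_alg_closed; simp add: U_gens_simps)
       apply (intro free_alg_closed; simp add: U_gens_simps)
      apply (intro free_alg_closed; simp add: U_gens_simps)
     apply (simp split: if_split)
     apply (intro conjI impI free_alg_closed; simp add: U_gens_simps)
    apply (rule serre_in_free_alg; auto simp add: U_gens_simps)
    done
qed

lemma O_presentation: "presentation (O_gens n) (O_rels n q)"
proof
  have "\<sigma> k \<in> {1..n+1}" if "\<sigma> permutes {1..n+1}" "k \<in> {1..n+1}" for \<sigma> k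
    using that by (metis permutes_in_image)
  then have "map (\<lambda>k. (k, \<sigma> k)) [1..<n+2] \<in> lists (O_gens n)" if "\<sigma> permutes {1..n+1}" for \<sigma>
    using that unfolding O_gens_def lists_eq_set by fastforce
  then have "qdet n q \<in> carrier (free_alg (O_gens n))"
    unfolding qdet_def by (intro free_alg_closed) auto
  then show "O_rels n q \<subseteq> carrier (free_alg (O_gens n))"
    unfolding O_rels_def by (auto intro!: free_alg_closed simp: O_gens_def)
qed

abbreviation O_free :: "nat \<Rightarrow> ogen falg set" where
  "O_free n \<equiv> carrier (free_alg (O_gens n))"

abbreviation U_free :: "nat \<Rightarrow> ugen falg set" where
  "U_free n \<equiv> carrier (free_alg (U_gens n))"

locale quantum_pairing =
  fixes n :: nat and q :: real
    and P :: "ugen falg set \<Rightarrow> ogen falg set \<Rightarrow> complex"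
  assumes n_pos: "1 \<le> n"
    and q_nonzero: "q \<noteq> 0"
    and pairing: "evaluation_pairing n q P"
begin

sublocale U: presentation "U_gens n" "U_rels n q"
  rewrites "presented_alg (U_gens n) (U_rels n q) = Uq n q"
    and "cls (U_gens n) (U_rels n q) = U_cls n q"
  by (simp_all add: U_presentation Uq_def U_cls_def fun_eq_iff)

sublocale O: presentation "O_gens n" "O_rels n q"
  rewrites "presented_alg (O_gens n) (O_rels n q) = Oq n q"
    and "cls (O_gens n) (O_rels n q) = O_cls n q"
  by (simp_all add: O_presentation Oq_def O_cls_def fun_eq_iff)

definition pr :: "ugen falg \<Rightarrow> ogen falg \<Rightarrow> complex" where
  "pr x p = P (U_cls n q x) (O_cls n q p)"

lemmas pairing_add_left = pairing[unfolded evaluation_pairing_def, THEN conjunct1]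
lemmas pairing_add_right = pairing[unfolded evaluation_pairing_def, THEN conjunct2, THEN conjunct1]
lemmas pairing_smult = pairing[unfolded evaluation_pairing_def, THEN conjunct2, THEN conjunct2, THEN conjunct1]
lemmas pairing_mult_right = pairing[unfolded evaluation_pairing_def, THEN conjunct2, THEN conjunct2, THEN conjunct2, THEN conjunct2, THEN conjunct2, THEN conjunct1]
lemmas pairing_mult_left = pairing[unfolded evaluation_pairing_def, THEN conjunct2, THEN conjunct2, THEN conjunct2, THEN conjunct2, THEN conjunct2, THEN conjunct2, THEN conjunct1]
lemmas pairing_gen = pairing[unfolded evaluation_pairing_def, THEN conjunct2, THEN conjunct2, THEN conjunct2, THEN conjunct2, THEN conjunct2, THEN conjunct2, THEN conjunct2]

lemma pr_add_left:
    "x \<in> U_free n \<Longrightarrow> y \<in> U_free n \<Longrightarrow> p \<in> O_free n \<Longrightarrow> pr (x + y) p = pr x p + pr y p"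
  unfolding pr_def U.cls_add
  by (intro pairing_add_left[rule_format] U.cls_closed O.cls_closed)

lemma pr_add_right:
    "x \<in> U_free n \<Longrightarrow> p \<in> O_free n \<Longrightarrow> r \<in> O_free n \<Longrightarrow> pr x (p + r) = pr x p + pr x r"
  unfolding pr_def O.cls_add
  by (intro pairing_add_right[rule_format] U.cls_closed O.cls_closed)

lemma pr_smult_left: "x \<in> U_free n \<Longrightarrow> p \<in> O_free n \<Longrightarrow> pr (const c * x) p = c * pr x p"
  unfolding pr_def U.cls_smult
  by (intro pairing_smult[rule_format, THEN conjunct1] U.cls_closed O.cls_closed)

lemma pr_smult_right: "x \<in> U_free n \<Longrightarrow> p \<in> O_free n \<Longrightarrow> pr x (const c * p) = c * pr x p"
  unfolding pr_def O.cls_smult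
  by (intro pairing_smult[rule_format, THEN conjunct2] U.cls_closed O.cls_closed)

lemma pr_mult_right:
  "x \<in> U_free n \<Longrightarrow> p \<in> O_free n \<Longrightarrow> r \<in> O_free n \<Longrightarrow>
    pr x (p * r) = sweedler_sum (U_coprod x) (\<lambda>v w. pr (word v) p * pr (word w) r)"
  unfolding pr_def O.cls_mult
  by (intro pairing_mult_right[rule_format] U.cls_closed O.cls_closed)

lemma pr_mult_left:
  "x \<in> U_free n \<Longrightarrow> y \<in> U_free n \<Longrightarrow> w \<in> lists (O_gens n) \<Longrightarrow>
    pr (x * y) (word w) = conv n (\<lambda>v. pr x (word v)) (\<lambda>v. pr y (word v)) w"
  unfolding pr_def conv_def U.cls_mult
  by (intro pairing_mult_left[rule_format] U.cls_closed word_in_free_alg)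

lemma pr_gen:
  "x \<in> U_gens n \<Longrightarrow> (i, j) \<in> O_gens n \<Longrightarrow> pr (gen x) (gen (i, j)) = gen_pairing q x (i, j)"
  using pairing_gen unfolding pr_def u_def by fast

lemma pr_diff_left:
  "x \<in> U_free n \<Longrightarrow> y \<in> U_free n \<Longrightarrow> p \<in> O_free n \<Longrightarrow> pr (x - y) p = pr x p - pr y p"
  using pr_add_left[of "x - y" y p] by (simp add: diff_in_free_alg)

lemma pr_diff_right:
  "x \<in> U_free n \<Longrightarrow> p \<in> O_free n \<Longrightarrow> r \<in> O_free n \<Longrightarrow> pr x (p - r) = pr x p - pr x r"
  using pr_add_right[of x "p - r" r] by (simp add: diff_in_free_alg)

lemma pr_zero_left [simp]: "p \<in> O_free n \<Longrightarrow> pr 0 p = 0"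
  and pr_zero_right [simp]: "x \<in> U_free n \<Longrightarrow> pr x 0 = 0"
  using pr_diff_left[of 0 0 p] pr_diff_right[of x 0 0] by (simp_all add: zero_in_free_alg)

lemma pr_sum_left:
  "(\<And>a. a \<in> A \<Longrightarrow> f a \<in> U_free n) \<Longrightarrow> p \<in> O_free n \<Longrightarrow> pr (sum f A) p = (\<Sum>a\<in>A. pr (f a) p)"
  by (induction A rule: infinite_finite_induct) (simp_all add: pr_add_left sum_in_free_alg)

lemma pr_sum_right:
  "(\<And>a. a \<in> A \<Longrightarrow> f a \<in> O_free n) \<Longrightarrow> x \<in> U_free n \<Longrightarrow> pr x (sum f A) = (\<Sum>a\<in>A. pr x (f a))"
  by (induction A rule: infinite_finite_induct) (simp_all add: pr_add_right sum_in_free_alg)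

text \<open>A group-like element defines a multiplicative functional. In particular its value at the unit is
  \<open>1\<close> as soon as it has a non-zero value somewhere, which is how \<open>pr_one_one\<close> and \<open>pr_K_one\<close> arise.\<close>

lemma pr_grouplike_mult:
  assumes "g = 1 \<or> (\<exists>i\<in>{1..n}. g = gen (K i) \<or> g = gen (L i))" "p \<in> O_free n" "r \<in> O_free n"
  shows "pr g (p * r) = pr g p * pr g r"
proof -
  have "(1 :: ugen ftens) = tens [] []"
    unfolding tens_def by (metis single_one zero_list_def zero_prod_def)
  then have one: "sweedler_sum (1 :: ugen ftens) f = f [] []" for f
    using sweedler_sum_tens by metis
  have g: "g \<in> U_free n"
    using assms(1) by (auto intro!: free_alg_closed simp: U_gens_simps)
  have "U_coprod (word []) = 1" "U_coprod (word [x]) = U_coprod_gen x" for x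
    unfolding U_coprod_def by (simp_all add: free_lift_word)
  then show ?thesis
    unfolding pr_mult_right[OF g assms(2,3)] using assms(1)
    by (auto simp: one gen_def simp flip: word_Nil)
qed

lemma pr_E_mult:
  assumes "i \<in> {1..n}" "p \<in> O_free n" "r \<in> O_free n"
  shows "pr (gen (E i)) (p * r)
    = pr (gen (E i)) p * pr (gen (K i)) r + pr 1 p * pr (gen (E i)) r"
  using pr_mult_right[OF gen_in_free_alg assms(2,3), of "E i"] assms(1)
  by (simp add: U_gens_simps gen_def U_coprod_def free_lift_word sweedler_sum_plus flip: word_Nil)

text \<open>The counit is the functional of $1 = K_1 K_1^{-1}$, which is a convolution of two known diagonal
  functionals. This avoids showing that \<open>O_counit\<close>, the element of the image of a coset, does not
  depend on the representative.\<close>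

lemma pr_one_gen:
  assumes kl: "(k, l) \<in> O_gens n"
  shows "pr 1 (gen (k, l)) = of_bool (k = l)"
proof -
  have g: "K 1 \<in> U_gens n" "L 1 \<in> U_gens n" using n_pos by (auto simp: U_gens_def)
  have "word [K 1, L 1] - 1 \<in> U_rels n q"
    unfolding U_rels_def by (intro UnI1 CollectI exI[of _ 1]) (use n_pos in simp)
  then have "U_cls n q (word [K 1, L 1]) = U_cls n q 1"
    using g by (intro U.cls_eqI free_alg_closed) auto
  then have "pr 1 (gen (k, l)) = pr (gen (K 1) * gen (L 1)) (word [(k, l)])"
    by (simp add: pr_def gen_def flip: word_append)
  also have "\<dots> = (\<Sum>m\<in>{1..n+1}. pr (gen (K 1)) (gen (k, m)) * pr (gen (L 1)) (gen (m, l)))"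
    using g kl by (subst pr_mult_left) (simp_all add: free_alg_closed conv_singleton gen_def del: sum.cl_ivl_Suc)
  also have "\<dots> = (\<Sum>m\<in>{1..n+1}. if m = k then of_bool (k = l) else 0)"
    using g kl q_nonzero
    by (intro sum.cong) (auto simp: pr_gen O_gens_def cq_add[symmetric])
  finally show ?thesis using kl by (simp add: O_gens_def del: sum.cl_ivl_Suc)
qed

lemma pr_K_gen:
  assumes "i \<in> {1..n}" "(k, l) \<in> O_gens n"
  shows "pr (gen (K i)) (gen (k, l)) = of_bool (k = l) * cq q (of_bool (i + 1 = k) - of_bool (i = k))"
  using assms by (auto simp: pr_gen U_gens_simps)

lemma pr_one_one [simp]: "pr 1 1 = 1"
proof -
  have "(1, 1) \<in> O_gens n" by (simp add: O_gens_def)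
  then show ?thesis
    using pr_grouplike_mult[of 1 1 "gen (1, 1)"] pr_one_gen[of 1 1]
    by (simp add: free_alg_closed)
qed

lemma pr_K_one [simp]:
  assumes "i \<in> {1..n}"
  shows "pr (gen (K i)) 1 = 1"
proof -
  have "(1, 1) \<in> O_gens n" by (simp add: O_gens_def)
  then show ?thesis
    using pr_grouplike_mult[of "gen (K i)" 1 "gen (1, 1)"] pr_K_gen[of i 1 1]
      cq_nonzero[OF q_nonzero] assms
    by (simp add: free_alg_closed bexI[of _ i])
qed

lemma pr_E_one [simp]:
  assumes "i \<in> {1..n}"
  shows "pr (gen (E i)) 1 = 0"
  using pr_E_mult[OF assms one_in_free_alg one_in_free_alg] assms by simp

end

section \<open>Root vectors act by a twisted Leibniz rule\<close>

text \<open>A representative of \<open>root_vec\<close> in the free algebra, given by the same recursion.\<close>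

primrec root_rep :: "real \<Rightarrow> nat \<Rightarrow> nat \<Rightarrow> ugen falg" where
  "root_rep q 0 i = 0"
| "root_rep q (Suc j) i =
     (if j = i then gen (E i)
      else gen (E j) * root_rep q j i - const (cq q (-1)) * (root_rep q j i * gen (E j)))"

context quantum_pairing
begin

lemma root_rep_closed: "1 \<le> i \<Longrightarrow> i < j \<Longrightarrow> j \<le> n + 1 \<Longrightarrow> root_rep q j i \<in> U_free n"
proof (induction j)
  case (Suc j)
  then show ?case
    by (cases "j = i") (auto intro!: free_alg_closed simp: U_gens_simps)
qed simp

lemma root_vec_eq: "1 \<le> i \<Longrightarrow> i < j \<Longrightarrow> j \<le> n + 1 \<Longrightarrow> root_vec n q j i = U_cls n q (root_rep q j i)"
proof (induction j)
  case (Suc j)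
  show ?case
  proof (cases "j = i")
    case False
    then have *: "root_rep q j i \<in> U_free n" "gen (E j) \<in> U_free n"
      using Suc.prems by (auto intro!: root_rep_closed free_alg_closed simp: U_gens_simps)
    have "root_vec n q j i = U_cls n q (root_rep q j i)" using Suc False by simp
    with False * show ?thesis
      by (simp add: qcomm_def free_alg_closed flip: U.cls_mult U.cls_smult U.cls_diff)
  qed simp
qed simp

text \<open>\<open>root_rep q l i\<close> is a polynomial in the generators \<open>E i, \<dots>, E (l - 1)\<close>, and the Serre
  relations make each of these commute with \<open>E j\<close> as soon as their indices differ from \<open>j\<close> by at
  least two.\<close>

lemma root_rep_commute:
  assumes "1 \<le> i" "i < l" "l < j" "j \<le> n"
  shows "U_cls n q (gen (E j) * root_rep q l i) = U_cls n q (root_rep q l i * gen (E j))"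
  using assms(2,3)
proof (induction l)
  case (Suc l)
  have commute: "U_cls n q (gen (E j) * gen (E m)) = U_cls n q (gen (E m) * gen (E j))"
    if m: "1 \<le> m" "m + 1 < j" for m
  proof (rule U.cls_eqI)
    have "serre q E j m \<in> U_rels n q"
      unfolding U_rels_def using m assms(4)
      by (intro UnI2 CollectI exI[of _ E] exI[of _ j] exI[of _ m]) simp
    then show "gen (E j) * gen (E m) - gen (E m) * gen (E j) \<in> U_rels n q"
      using m by (simp add: serre_def gen_def flip: word_append)
  qed (use m assms(4) in \<open>auto intro!: free_alg_closed simp: U_gens_simps\<close>)
  show ?case
  proof (cases "l = i")
    case True
    then show ?thesis using commute[of l] assms Suc.prems by simp
  next
    case False
    let ?g = "gen (E j)" and ?h = "gen (E l)" and ?r = "root_rep q l i" and ?U = "Uq n q"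
    let ?G = "U_cls n q ?g" and ?H = "U_cls n q ?h" and ?R = "U_cls n q ?r" and ?c = "U_cls n q (const (cq q (-1)))"
    have cl: "?g \<in> U_free n" "?h \<in> U_free n" "?r \<in> U_free n" "const (cq q (-1)) \<in> U_free n"
      using Suc.prems assms False by (auto intro!: root_rep_closed free_alg_closed simp: U_gens_simps)
    then have Cl: "?G \<in> carrier ?U" "?H \<in> carrier ?U" "?R \<in> carrier ?U" "?c \<in> carrier ?U"
      by (auto intro: U.cls_closed)
    have gh: "?G \<otimes>\<^bsub>?U\<^esub> ?H = ?H \<otimes>\<^bsub>?U\<^esub> ?G"
      using commute[of l] Suc.prems assms cl by (simp add: U.cls_mult)
    have gr: "?G \<otimes>\<^bsub>?U\<^esub> ?R = ?R \<otimes>\<^bsub>?U\<^esub> ?G"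
      using Suc False cl by (simp add: U.cls_mult)
    have gc: "?G \<otimes>\<^bsub>?U\<^esub> ?c = ?c \<otimes>\<^bsub>?U\<^esub> ?G"
      using cl by (simp add: const_commute flip: U.cls_mult)
    have swap: "?G \<otimes>\<^bsub>?U\<^esub> (X \<otimes>\<^bsub>?U\<^esub> Y) = (X \<otimes>\<^bsub>?U\<^esub> Y) \<otimes>\<^bsub>?U\<^esub> ?G"
      if "?G \<otimes>\<^bsub>?U\<^esub> X = X \<otimes>\<^bsub>?U\<^esub> ?G" "?G \<otimes>\<^bsub>?U\<^esub> Y = Y \<otimes>\<^bsub>?U\<^esub> ?G"
        "X \<in> carrier ?U" "Y \<in> carrier ?U" for X Y
      using that Cl(1) by (metis U.pres.m_assoc)
    have "U_cls n q (?g * root_rep q (Suc l) i)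
      = U_cls n q (?g * (?h * ?r)) \<ominus>\<^bsub>?U\<^esub> U_cls n q (?g * (const (cq q (-1)) * (?r * ?h)))"
      using False cl by (simp add: right_diff_distrib U.cls_diff free_alg_closed)
    also have "\<dots> = U_cls n q ((?h * ?r) * ?g) \<ominus>\<^bsub>?U\<^esub> U_cls n q ((const (cq q (-1)) * (?r * ?h)) * ?g)"
      using cl Cl swap gh gr gc by (simp add: U.cls_mult free_alg_closed)
    also have "\<dots> = U_cls n q (root_rep q (Suc l) i * ?g)"
      using False cl by (simp add: left_diff_distrib free_alg_closed flip: U.cls_diff)
    finally show ?thesis .
  qed
qed simp

definition eps_word :: "ogen list \<Rightarrow> complex" where
  "eps_word w = pr 1 (word w)"

definition E_word :: "nat \<Rightarrow> ogen list \<Rightarrow> complex" where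
  "E_word j w = pr (gen (E j)) (word w)"

definition root_word :: "nat \<Rightarrow> nat \<Rightarrow> ogen list \<Rightarrow> complex" where
  "root_word j i w = pr (root_rep q j i) (word w)"

lemma conv_eps_left:
    "x \<in> U_free n \<Longrightarrow> w \<in> lists (O_gens n) \<Longrightarrow> conv n eps_word (\<lambda>v. pr x (word v)) w = pr x (word w)"
  and conv_eps_right:
    "x \<in> U_free n \<Longrightarrow> w \<in> lists (O_gens n) \<Longrightarrow> conv n (\<lambda>v. pr x (word v)) eps_word w = pr x (word w)"
  using pr_mult_left[of 1 x w] pr_mult_left[of x 1 w]
  by (simp_all add: eps_word_def[abs_def] one_in_free_alg)

lemma root_word_Suc:
  assumes "1 \<le> i" "i < j" "j \<le> n" "w \<in> lists (O_gens n)"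
  shows "root_word (Suc j) i w
    = conv n (E_word j) (root_word j i) w - cq q (-1) * conv n (root_word j i) (E_word j) w"
proof -
  have cl: "root_rep q j i \<in> U_free n" "gen (E j) \<in> U_free n"
    using assms by (auto intro!: root_rep_closed free_alg_closed simp: U_gens_simps)
  then have "pr (const (cq q (-1)) * (root_rep q j i * gen (E j))) (word w)
    = cq q (-1) * pr (root_rep q j i * gen (E j)) (word w)"
    using cl assms(4) by (intro pr_smult_left mult_in_free_alg word_in_free_alg)
  then show ?thesis
    using assms cl
    by (simp add: root_word_def[abs_def] E_word_def[abs_def] pr_diff_left pr_mult_left[OF _ _ assms(4)]
      mult_in_free_alg const_in_free_alg word_in_free_alg)
qed

lemma conv_commute:
  assumes "1 \<le> i" "i < l" "l < j" "j \<le> n" "w \<in> lists (O_gens n)"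
  shows "conv n (E_word j) (root_word l i) w = conv n (root_word l i) (E_word j) w"
proof -
  have "root_rep q l i \<in> U_free n" "gen (E j) \<in> U_free n"
    using assms by (auto intro!: root_rep_closed free_alg_closed simp: U_gens_simps)
  moreover have "pr (gen (E j) * root_rep q l i) (word w) = pr (root_rep q l i * gen (E j)) (word w)"
    unfolding pr_def root_rep_commute[OF assms(1-4)] ..
  ultimately show ?thesis
    using assms(5) by (simp add: pr_mult_left root_word_def[abs_def] E_word_def[abs_def])
qed

lemma E_word_snoc:
  assumes "1 \<le> i" "i \<le> n" "w \<in> lists (O_gens n)" "(k, l) \<in> O_gens n"
  shows "E_word i (w @ [(k, l)])
    = of_bool (k = l) * cq q (of_bool (i + 1 = k) - of_bool (i = k)) * E_word i w
      + of_bool (k = i + 1 \<and> l = i) * eps_word w"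
proof -
  have "word (w @ [(k, l)]) = word w * gen (k, l)" by (simp add: word_append gen_def)
  then show ?thesis
    using assms pr_E_mult[of i "word w" "gen (k, l)"] pr_K_gen[of i k l] pr_gen[of "E i" k l]
    by (simp add: E_word_def eps_word_def free_alg_closed U_gens_simps)
qed

lemma sum_of_bool_eq:
  "finite A \<Longrightarrow> (\<Sum>m\<in>A. of_bool (k = m) * h m) = of_bool (k \<in> A) * (h k :: 'c :: comm_ring_1)"
  by (simp add: of_bool_def if_distrib[of "\<lambda>x. x * _"] cong: if_cong)

text \<open>
  For the step from $j$ to $j + 1$, put $e = E_j$ and $f = E_{ji}$ as functionals. As $e(v\,u_{km})$ vanishes
  unless $m = k$, or $m = j$ and $k = j + 1$, the sum over $m$ in $(e * f)(w\,u_{kl})$ has at most two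
  terms; the same holds for $(f * e)(w\,u_{kl})$. The induction hypothesis for $f$ then leaves the following.
  The diagonal terms combine to a multiple of $e * f - q^{-1} f * e$. For $k = j$ and $l = i$ the two
  contributions $q^{-1} e(w)$ cancel; for $k = j$ and $i < l < j$ there remains a multiple of
  $e * f_{li} - f_{li} * e = 0$. For $k = j + 1$ and $l = j$ the contributions $q f(w)$ and
  $q^{-1} f(w)$ produce the new term $\nu f(w)$, and the other terms for $k = j + 1$ are those of
  $f(w\,u_{jl})$, passed on by the counit in $e(v\,u_{j+1,j})$.
\<close>

lemma root_word_snoc:
  assumes "1 \<le> i" "i < j" "j \<le> n + 1" "w \<in> lists (O_gens n)" "(k, l) \<in> O_gens n"
  shows "root_word j i (w @ [(k, l)])
    = of_bool (k = l) * cq q (of_bool (j = k) - of_bool (i = k)) * root_word j i w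
      + of_bool (k = j \<and> l = i) * eps_word w
      + of_bool (k = j \<and> i < l \<and> l < j) * (cq q 1 - cq q (-1)) * root_word l i w"
  using assms(2,3,4,5)
proof (induction j arbitrary: w k l)
  case (Suc j)
  note w = Suc.prems(3) and kl = Suc.prems(4)
  show ?case
  proof (cases "j = i")
    case True
    have [simp]: "root_word (Suc i) i = E_word i"
      by (simp add: root_word_def[abs_def] E_word_def[abs_def])
    show ?thesis
      using E_word_snoc[of i w k l] w kl assms(1) Suc.prems True by simp
  next
    case False
    then have ij: "i < j" "j \<le> n" using Suc.prems by auto
    have mem: "(k, m) \<in> O_gens n \<longleftrightarrow> m \<in> {1..n+1}" "(m, l) \<in> O_gens n \<longleftrightarrow> m \<in> {1..n+1}" for m
      using kl by (auto simp: O_gens_def)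
    have kl': "k \<in> {1..n+1}" "l \<in> {1..n+1}" using kl by (auto simp: O_gens_def)
    let ?e = "E_word j" and ?f = "root_word j i" and ?\<nu> = "cq q 1 - cq q (-1)"
    let ?c = "cq q (of_bool (j + 1 = k) - of_bool (j = k))"
    let ?d = "cq q (of_bool (j + 1 = l) - of_bool (j = l))"
    have e: "?e (v @ [(k, m)]) = of_bool (k = m) * (?c * ?e v) + of_bool (j = m) * (of_bool (k = j + 1) * eps_word v)"
        "?e (v @ [(m, l)]) = of_bool (l = m) * (?d * ?e v) + of_bool (j + 1 = m) * (of_bool (l = j) * eps_word v)"
      if "v \<in> lists (O_gens n)" "m \<in> {1..n+1}" for v m
      using E_word_snoc[of j v k m] E_word_snoc[of j v m l] that ij assms(1) mem by (auto simp: of_bool_def)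
    have A: "conv n ?e ?f (w @ [(k, l)])
      = ?c * conv n ?e (\<lambda>v. ?f (v @ [(k, l)])) w
        + of_bool (k = j + 1) * conv n eps_word (\<lambda>v. ?f (v @ [(j, l)])) w"
    proof -
      have "conv n ?e ?f (w @ [(k, l)]) = (\<Sum>m\<in>{1..n+1}.
          of_bool (k = m) * (?c * conv n ?e (\<lambda>v. ?f (v @ [(m, l)])) w)
          + of_bool (j = m) * (of_bool (k = j + 1) * conv n eps_word (\<lambda>v. ?f (v @ [(m, l)])) w))"
        unfolding conv_snoc
      proof (rule sum.cong[OF refl])
        fix m assume m: "m \<in> {1..n+1}"
        have "conv n (\<lambda>v. ?e (v @ [(k, m)])) (\<lambda>v. ?f (v @ [(m, l)])) w
          = conv n (\<lambda>v. of_bool (k = m) * (?c * ?e v) + of_bool (j = m) * (of_bool (k = j + 1) * eps_word v))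
              (\<lambda>v. ?f (v @ [(m, l)])) w"
          by (rule conv_cong[OF w]) (use e m in auto)
        then show "conv n (\<lambda>v. ?e (v @ [(k, m)])) (\<lambda>v. ?f (v @ [(m, l)])) w
          = of_bool (k = m) * (?c * conv n ?e (\<lambda>v. ?f (v @ [(m, l)])) w)
          + of_bool (j = m) * (of_bool (k = j + 1) * conv n eps_word (\<lambda>v. ?f (v @ [(m, l)])) w)"
          by (simp only: conv_linear)
      qed
      also have "\<dots> = ?c * conv n ?e (\<lambda>v. ?f (v @ [(k, l)])) w
        + of_bool (k = j + 1) * conv n eps_word (\<lambda>v. ?f (v @ [(j, l)])) w"
        using kl' ij assms(1) by (simp add: sum.distrib sum_of_bool_eq del: sum.cl_ivl_Suc)
      finally show ?thesis .
    qed
    have B: "conv n ?f ?e (w @ [(k, l)])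
      = ?d * conv n (\<lambda>v. ?f (v @ [(k, l)])) ?e w
        + of_bool (l = j) * conv n (\<lambda>v. ?f (v @ [(k, j + 1)])) eps_word w"
    proof -
      have "conv n ?f ?e (w @ [(k, l)]) = (\<Sum>m\<in>{1..n+1}.
          of_bool (l = m) * (?d * conv n (\<lambda>v. ?f (v @ [(k, m)])) ?e w)
          + of_bool (j + 1 = m) * (of_bool (l = j) * conv n (\<lambda>v. ?f (v @ [(k, m)])) eps_word w))"
        unfolding conv_snoc
      proof (rule sum.cong[OF refl])
        fix m assume m: "m \<in> {1..n+1}"
        have "conv n (\<lambda>v. ?f (v @ [(k, m)])) (\<lambda>v. ?e (v @ [(m, l)])) w
          = conv n (\<lambda>v. ?f (v @ [(k, m)]))
              (\<lambda>v. of_bool (l = m) * (?d * ?e v) + of_bool (j + 1 = m) * (of_bool (l = j) * eps_word v)) w"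
          by (rule conv_cong[OF w]) (use e m in auto)
        then show "conv n (\<lambda>v. ?f (v @ [(k, m)])) (\<lambda>v. ?e (v @ [(m, l)])) w
          = of_bool (l = m) * (?d * conv n (\<lambda>v. ?f (v @ [(k, m)])) ?e w)
          + of_bool (j + 1 = m) * (of_bool (l = j) * conv n (\<lambda>v. ?f (v @ [(k, m)])) eps_word w)"
          by (simp only: conv_linear)
      qed
      also have "\<dots> = ?d * conv n (\<lambda>v. ?f (v @ [(k, l)])) ?e w
        + of_bool (l = j) * conv n (\<lambda>v. ?f (v @ [(k, j + 1)])) eps_word w"
        using kl' ij assms(1) by (simp add: sum.distrib sum_of_bool_eq del: sum.cl_ivl_Suc)
      finally show ?thesis .
    qed
    have IH: "?f (v @ [(a, b)])
      = (of_bool (a = b) * cq q (of_bool (j = a) - of_bool (i = a))) * ?f v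
        + of_bool (a = j \<and> b = i) * eps_word v
        + (of_bool (a = j \<and> i < b \<and> b < j) * ?\<nu>) * root_word b i v"
      if "v \<in> lists (O_gens n)" "a \<in> {1..n+1}" "b \<in> {1..n+1}" for v a b
      using Suc.IH[of v a b] that ij by (simp add: O_gens_def)
    have left: "conv n g (\<lambda>v. ?f (v @ [(a, b)])) w
      = (of_bool (a = b) * cq q (of_bool (j = a) - of_bool (i = a))) * conv n g ?f w
        + of_bool (a = j \<and> b = i) * conv n g eps_word w
        + (of_bool (a = j \<and> i < b \<and> b < j) * ?\<nu>) * conv n g (root_word b i) w"
      if "a \<in> {1..n+1}" "b \<in> {1..n+1}" for g a b
    proof -
      have "conv n g (\<lambda>v. ?f (v @ [(a, b)])) w = conv n g (\<lambda>v. (of_bool (a = b) * cq q (of_bool (j = a) - of_bool (i = a))) * ?f v + of_bool (a = j \<and> b = i) * eps_word v + (of_bool (a = j \<and> i < b \<and> b < j) * ?\<nu>) * root_word b i v) w"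
        by (rule conv_cong[OF w]) (use IH that in auto)
      then show ?thesis by (simp only: conv_linear)
    qed
    have right: "conv n (\<lambda>v. ?f (v @ [(a, b)])) g w
      = (of_bool (a = b) * cq q (of_bool (j = a) - of_bool (i = a))) * conv n ?f g w
        + of_bool (a = j \<and> b = i) * conv n eps_word g w
        + (of_bool (a = j \<and> i < b \<and> b < j) * ?\<nu>) * conv n (root_word b i) g w"
      if "a \<in> {1..n+1}" "b \<in> {1..n+1}" for g a b
    proof -
      have "conv n (\<lambda>v. ?f (v @ [(a, b)])) g w = conv n (\<lambda>v. (of_bool (a = b) * cq q (of_bool (j = a) - of_bool (i = a))) * ?f v + of_bool (a = j \<and> b = i) * eps_word v + (of_bool (a = j \<and> i < b \<and> b < j) * ?\<nu>) * root_word b i v) g w"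
        by (rule conv_cong[OF w]) (use IH that in auto)
      then show ?thesis by (simp only: conv_linear)
    qed
    have units: "conv n eps_word ?e w = ?e w" "conv n ?e eps_word w = ?e w"
      "conv n eps_word eps_word w = eps_word w"
      using w ij assms(1) conv_eps_left[of 1 w] conv_eps_left[of "gen (E j)" w] conv_eps_right[of "gen (E j)" w]
      by (simp_all add: free_alg_closed U_gens_simps E_word_def[abs_def] eps_word_def[abs_def])
    have units': "conv n eps_word (root_word b i) w = root_word b i w"
        "conv n (root_word b i) eps_word w = root_word b i w" if "i < b" "b \<le> j" for b
      using w ij assms(1) that conv_eps_left[of "root_rep q b i" w] conv_eps_right[of "root_rep q b i" w]
      by (simp_all add: root_rep_closed root_word_def[abs_def])
    have j: "j \<in> {1..n+1}" "j + 1 \<in> {1..n+1}" using ij assms(1) by auto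
    have comm: "conv n ?e (root_word b i) w = conv n (root_word b i) ?e w" if "i < b" "b < j" for b
      using conv_commute[OF assms(1) that ij(2) w] .
    have wkl: "w @ [(k, l)] \<in> lists (O_gens n)" using w kl by simp
    have cqs: "cq q 1 * cq q (-1) = 1" "cq q (-1) * cq q 1 = 1"
      using cq_add[OF q_nonzero, of 1 "-1"] by (simp_all add: mult.commute)
    have cqs': "cq q 1 * (cq q (-1) * x) = x" "cq q (-1) * (cq q 1 * x) = x" for x
      by (simp_all add: cqs flip: mult.assoc)
    note expand = root_word_Suc[OF assms(1) ij wkl] root_word_Suc[OF assms(1) ij w] A B
        left[OF kl'] left[OF j(1) kl'(2)] right[OF kl'] right[OF kl'(1) j(2)] units
    show ?thesis
    proof (cases "k = l")
      case True
      then consider "k = j + 1" | "k = j" | "k = i" | "k \<noteq> j + 1" "k \<noteq> j" "k \<noteq> i" by blast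
      then show ?thesis
        unfolding expand by cases (use True ij units' in \<open>simp_all add: cqs cqs' algebra_simps\<close>)
    next
      case False
      then consider "k = j + 1" "l = j" | "k = j + 1" "l = i" | "k = j + 1" "i < l" "l < j"
        | "k = j + 1" "l < i \<or> j + 1 < l" | "k = j" "l = i" | "k = j" "i < l" "l < j"
        | "k = j" "l < i \<or> j < l" | "k \<noteq> j + 1" "k \<noteq> j"
        by linarith
      then show ?thesis
        unfolding expand by cases (use False ij units' comm in \<open>auto simp: cqs cqs' algebra_simps\<close>)
    qed
  qed
qed simp

end

section \<open>The right ideal\<close>

context quantum_pairing
begin

lemma cls_eq_zero_rel: "p \<in> O_rels n q \<Longrightarrow> O_cls n q p = \<zero>\<^bsub>Oq n q\<^esub>"
  using O.cls_eqI[of p 0] O.rels by (auto simp: O.cls_zero zero_in_free_alg)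

lemma pos_rootsD: "(i, j) \<in> pos_roots n \<Longrightarrow> 1 \<le> i \<and> i < j \<and> j \<le> n + 1"
  by (simp add: pos_roots_def)

lemma finite_pos_roots: "finite (pos_roots n)"
  by (rule finite_subset[of _ "{1..n+1} \<times> {1..n+1}"]) (auto simp: pos_roots_def)

lemma root_closed: "(i, j) \<in> pos_roots n \<Longrightarrow> root_rep q j i \<in> U_free n"
  by (auto simp: pos_roots_def intro: root_rep_closed)

lemma pos_root_gens: "(i, j) \<in> pos_roots n \<Longrightarrow> (i, j) \<in> O_gens n \<and> (j, i) \<in> O_gens n"
  by (auto simp: pos_roots_def O_gens_def)

lemma pr_one_snoc:
  "p \<in> O_free n \<Longrightarrow> (k, l) \<in> O_gens n \<Longrightarrow> pr 1 (p * gen (k, l)) = of_bool (k = l) * pr 1 p"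
  using pr_grouplike_mult[of 1 p "gen (k, l)"] pr_one_gen[of k l] by (simp add: gen_in_free_alg)

text \<open>The rule extends from words to all elements by linearity.\<close>

lemma pr_root_snoc:
  assumes ij: "(i, j) \<in> pos_roots n" and p: "p \<in> O_free n" and kl: "(k, l) \<in> O_gens n"
  shows "pr (root_rep q j i) (p * gen (k, l))
    = of_bool (k = l) * cq q (of_bool (j = k) - of_bool (i = k)) * pr (root_rep q j i) p
      + of_bool (k = j \<and> l = i) * pr 1 p
      + of_bool (k = j \<and> i < l \<and> l < j) * (cq q 1 - cq q (-1)) * pr (root_rep q l i) p"
  using p
proof (induction p rule: free_alg_word_induct)
  case (word w)
  then show ?case
    using root_word_snoc[of i j w k l] kl pos_rootsD[OF ij]
    by (simp add: root_word_def eps_word_def word_append gen_def)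
next
  case (add p r)
  have "pr (root_rep q l i) (p + r) = pr (root_rep q l i) p + pr (root_rep q l i) r" if "i < l" "l < j"
    using that add(1,2) pos_rootsD[OF ij] by (intro pr_add_right root_rep_closed) auto
  then have *: "of_bool (k = j \<and> i < l \<and> l < j) * (cq q 1 - cq q (-1)) * pr (root_rep q l i) (p + r)
    = of_bool (k = j \<and> i < l \<and> l < j) * (cq q 1 - cq q (-1)) * pr (root_rep q l i) p
      + of_bool (k = j \<and> i < l \<and> l < j) * (cq q 1 - cq q (-1)) * pr (root_rep q l i) r"
    by (auto simp: algebra_simps)
  have "pr (root_rep q j i) ((p + r) * gen (k, l))
    = pr (root_rep q j i) (p * gen (k, l)) + pr (root_rep q j i) (r * gen (k, l))"
    unfolding distrib_right
    by (intro pr_add_right root_closed[OF ij] mult_in_free_alg gen_in_free_alg kl add(1,2))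
  then show ?case
    unfolding * add.IH using add(1,2)
    by (simp add: pr_add_right root_closed[OF ij] one_in_free_alg distrib_left)
next
  case (smult c p)
  have "pr (root_rep q l i) (const c * p) = c * pr (root_rep q l i) p" if "i < l" "l < j"
    using that smult(1) pos_rootsD[OF ij] by (intro pr_smult_right root_rep_closed) auto
  then have *: "of_bool (k = j \<and> i < l \<and> l < j) * (cq q 1 - cq q (-1)) * pr (root_rep q l i) (const c * p)
    = c * (of_bool (k = j \<and> i < l \<and> l < j) * (cq q 1 - cq q (-1)) * pr (root_rep q l i) p)"
    by (auto simp: algebra_simps)
  have "pr (root_rep q j i) (const c * p * gen (k, l)) = c * pr (root_rep q j i) (p * gen (k, l))"
    unfolding mult.assoc
    by (intro pr_smult_right root_closed[OF ij] mult_in_free_alg gen_in_free_alg kl smult(1))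
  then show ?case
    unfolding * smult.IH using smult(1)
    by (simp add: pr_smult_right root_closed[OF ij] one_in_free_alg distrib_left)
qed

lemma pr_root_one:
  assumes "1 \<le> i" "i < j" "j \<le> n + 1"
  shows "pr (root_rep q j i) 1 = 0"
proof -
  have "root_word j i [] = 0"
    using assms(2,3)
  proof (induction j)
    case (Suc j)
    show ?case
    proof (cases "j = i")
      case False
      then have "i < j" "j \<le> n" using Suc.prems by auto
      then show ?thesis
        using Suc.IH assms(1) by (simp add: root_word_Suc conv_Nil)
    qed (use assms Suc.prems in \<open>simp add: root_word_def word_Nil\<close>)
  qed simp
  then show ?thesis by (simp add: root_word_def word_Nil)
qed

lemma pr_root_gen:
  assumes ij: "(i, j) \<in> pos_roots n" and kl: "(k, l) \<in> O_gens n"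
  shows "pr (root_rep q j i) (gen (k, l)) = of_bool (k = j \<and> l = i)"
proof -
  have "pr (root_rep q j i) 1 = 0" "i < l \<and> l < j \<longrightarrow> pr (root_rep q l i) 1 = 0"
    using pos_rootsD[OF ij] by (auto intro!: pr_root_one)
  then show ?thesis
    using pr_root_snoc[OF ij one_in_free_alg kl] by auto
qed

text \<open>The part of \<open>p\<close> seen by the counit and the root vectors, written in the dual basis.\<close>

definition linear_part :: "ogen falg \<Rightarrow> ogen falg" where
  "linear_part p = const (pr 1 p)
     + (\<Sum>x\<in>pos_roots n. const (pr (root_rep q (snd x) (fst x)) p) * gen (snd x, fst x))"

lemma root_sum_closed: "(\<Sum>x\<in>pos_roots n. const (c x) * gen (snd x, fst x)) \<in> O_free n"
  using pos_root_gens by (auto intro!: sum_in_free_alg mult_in_free_alg const_in_free_alg gen_in_free_alg)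

lemma linear_part_closed: "linear_part p \<in> O_free n"
  unfolding linear_part_def by (intro add_in_free_alg const_in_free_alg root_sum_closed)

lemma linear_part_add:
  assumes "p \<in> O_free n" "r \<in> O_free n"
  shows "linear_part (p + r) = linear_part p + linear_part r"
proof -
  have "pr (root_rep q (snd x) (fst x)) (p + r)
    = pr (root_rep q (snd x) (fst x)) p + pr (root_rep q (snd x) (fst x)) r" if "x \<in> pos_roots n" for x
    using that assms by (intro pr_add_right root_closed) auto
  then show ?thesis
    using assms by (simp add: linear_part_def pr_add_right one_in_free_alg const_add distrib_right sum.distrib)
qed

lemma linear_part_smult:
  assumes "p \<in> O_free n"
  shows "linear_part (const c * p) = const c * linear_part p"
proof -
  have "pr (root_rep q (snd x) (fst x)) (const c * p) = c * pr (root_rep q (snd x) (fst x)) p"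
    if "x \<in> pos_roots n" for x
    using that assms by (intro pr_smult_right root_closed) auto
  then show ?thesis
    using assms by (simp add: linear_part_def pr_smult_right one_in_free_alg const_mult distrib_left
      sum_distrib_left mult.assoc)
qed

lemma linear_part_eqI:
  assumes "pr 1 p = c" "\<And>i j. (i, j) \<in> pos_roots n \<Longrightarrow> pr (root_rep q j i) p = d (i, j)"
  shows "linear_part p = const c + (\<Sum>x\<in>pos_roots n. const (d x) * gen (snd x, fst x))"
  unfolding linear_part_def using assms by (auto intro!: sum.cong)

lemma linear_part_single:
  assumes "pr 1 p = c" "(a, b) \<in> pos_roots n"
    "\<And>i j. (i, j) \<in> pos_roots n \<Longrightarrow> pr (root_rep q j i) p = of_bool (i = a \<and> j = b) * d"
  shows "linear_part p = const c + const d * gen (b, a)"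
proof -
  have "(\<Sum>x\<in>pos_roots n. const (of_bool (x = (a, b)) * d) * gen (snd x, fst x))
    = (\<Sum>x\<in>pos_roots n. if x = (a, b) then const d * gen (b, a) else 0)"
    by (rule sum.cong) (auto simp: of_bool_def)
  also have "\<dots> = const d * gen (b, a)"
    using assms(2) finite_pos_roots by simp
  finally show ?thesis
    using linear_part_eqI[of p c "\<lambda>x. of_bool (x = (a, b)) * d"] assms by simp
qed

lemma pr_root_sum:
  fixes c :: "nat \<times> nat \<Rightarrow> complex"
  defines "s \<equiv> \<Sum>x\<in>pos_roots n. const (c x) * gen (snd x, fst x)"
  shows "pr 1 s = 0" and "(i, j) \<in> pos_roots n \<Longrightarrow> pr (root_rep q j i) s = c (i, j)"
proof -
  have gen: "(snd x, fst x) \<in> O_gens n" if "x \<in> pos_roots n" for x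
    using that pos_root_gens[of "fst x" "snd x"] by simp
  have main: "pr X s = (\<Sum>x\<in>pos_roots n. c x * pr X (gen (snd x, fst x)))" if X: "X \<in> U_free n" for X
  proof -
    have "pr X s = (\<Sum>x\<in>pos_roots n. pr X (const (c x) * gen (snd x, fst x)))"
      unfolding s_def using gen by (intro pr_sum_right X mult_in_free_alg const_in_free_alg gen_in_free_alg)
    also have "\<dots> = (\<Sum>x\<in>pos_roots n. c x * pr X (gen (snd x, fst x)))"
      using gen by (intro sum.cong pr_smult_right X gen_in_free_alg refl)
    finally show ?thesis .
  qed
  have "pr 1 (gen (snd x, fst x)) = 0" if "x \<in> pos_roots n" for x
    using pr_one_gen[OF gen[OF that]] that pos_rootsD[of "fst x" "snd x"] by simp
  then show "pr 1 s = 0"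
    using main[OF one_in_free_alg] by simp
  assume ij: "(i, j) \<in> pos_roots n"
  have "(\<Sum>x\<in>pos_roots n. c x * pr (root_rep q j i) (gen (snd x, fst x)))
    = (\<Sum>x\<in>pos_roots n. if x = (i, j) then c (i, j) else 0)"
    by (rule sum.cong) (use pr_root_gen[OF ij gen] in auto)
  then show "pr (root_rep q j i) s = c (i, j)"
    using main[OF root_closed[OF ij]] ij finite_pos_roots by simp
qed

lemma pr_linear_part:
  assumes "p \<in> O_free n"
  shows "pr 1 (linear_part p) = pr 1 p"
    and "(i, j) \<in> pos_roots n \<Longrightarrow> pr (root_rep q j i) (linear_part p) = pr (root_rep q j i) p"
proof -
  have main: "pr X (linear_part p) = pr 1 p * pr X 1
      + pr X (\<Sum>x\<in>pos_roots n. const (pr (root_rep q (snd x) (fst x)) p) * gen (snd x, fst x))"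
    if "X \<in> U_free n" for X
    using pr_smult_right[OF that one_in_free_alg, of "pr 1 p"] that
    by (simp add: linear_part_def pr_add_right const_in_free_alg root_sum_closed)
  show "pr 1 (linear_part p) = pr 1 p"
    using main[OF one_in_free_alg] by (simp add: pr_root_sum)
  assume ij: "(i, j) \<in> pos_roots n"
  have "pr (root_rep q j i) 1 = 0" using pr_root_one pos_rootsD[OF ij] by auto
  then show "pr (root_rep q j i) (linear_part p) = pr (root_rep q j i) p"
    using main[OF root_closed[OF ij]] by (simp add: pr_root_sum ij)
qed

lemma O_carrier: "carrier (Oq n q) = O_cls n q ` O_free n"
  by (rule O.carrier_presented)

lemma O_counit_cls: "p \<in> O_free n \<Longrightarrow> O_counit (O_cls n q p) = pr 1 p"
  using pairing[unfolded evaluation_pairing_def, THEN conjunct2, THEN conjunct2, THEN conjunct2,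
      THEN conjunct2, THEN conjunct1, rule_format, of "O_cls n q p"]
  by (simp add: pr_def O.cls_closed U.cls_one)

lemma T01_eq:
  "T01 n q = {U_cls n q (\<Sum>x\<in>pos_roots n. const (c x) * root_rep q (snd x) (fst x)) | c. True}"
proof -
  have "(\<Oplus>\<^bsub>Uq n q\<^esub>x\<in>pos_roots n. c x \<odot>\<^bsub>Uq n q\<^esub> root_vec n q (snd x) (fst x))
    = U_cls n q (\<Sum>x\<in>pos_roots n. const (c x) * root_rep q (snd x) (fst x))" for c
  proof -
    have cl: "root_rep q (snd x) (fst x) \<in> U_free n"
        "root_vec n q (snd x) (fst x) = U_cls n q (root_rep q (snd x) (fst x))" if "x \<in> pos_roots n" for x
      using that pos_rootsD[of "fst x" "snd x"]
      by (simp_all add: root_rep_closed root_vec_eq)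
    then have "U_cls n q (\<Sum>x\<in>pos_roots n. const (c x) * root_rep q (snd x) (fst x))
      = (\<Oplus>\<^bsub>Uq n q\<^esub>x\<in>pos_roots n. U_cls n q (const (c x) * root_rep q (snd x) (fst x)))"
      by (intro U.cls_sum finite_pos_roots free_alg_closed) auto
    also have "\<dots> = (\<Oplus>\<^bsub>Uq n q\<^esub>x\<in>pos_roots n. c x \<odot>\<^bsub>Uq n q\<^esub> root_vec n q (snd x) (fst x))"
    proof (rule U.pres.finsum_cong')
      show "(\<lambda>x. c x \<odot>\<^bsub>Uq n q\<^esub> root_vec n q (snd x) (fst x)) \<in> pos_roots n \<rightarrow> carrier (Uq n q)"
        by (intro Pi_I) (simp only: cl U.cls_smult[symmetric] mult_in_free_alg const_in_free_alg U.cls_closed)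
    qed (simp_all add: cl U.cls_smult)
    finally show ?thesis by simp
  qed
  then show ?thesis unfolding T01_def by simp
qed

lemma I01_iff:
  assumes p: "p \<in> O_free n"
  shows "O_cls n q p \<in> I01 n q P \<longleftrightarrow>
    pr 1 p = 0 \<and> (\<forall>(i, j)\<in>pos_roots n. pr (root_rep q j i) p = 0)"
proof -
  let ?s = "\<lambda>c. \<Sum>x\<in>pos_roots n. const (c x) * root_rep q (snd x) (fst x)"
  have s: "P (U_cls n q (?s c)) (O_cls n q p) = (\<Sum>x\<in>pos_roots n. c x * pr (root_rep q (snd x) (fst x)) p)" for c
  proof -
    have "pr (?s c) p = (\<Sum>x\<in>pos_roots n. pr (const (c x) * root_rep q (snd x) (fst x)) p)"
      using root_closed p by (intro pr_sum_left) (auto intro!: free_alg_closed)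
    also have "\<dots> = (\<Sum>x\<in>pos_roots n. c x * pr (root_rep q (snd x) (fst x)) p)"
      using root_closed p by (intro sum.cong pr_smult_left) auto
    finally show ?thesis by (simp add: pr_def)
  qed
  have "(\<forall>X\<in>T01 n q. P X (O_cls n q p) = 0) \<longleftrightarrow>
    (\<forall>c. (\<Sum>x\<in>pos_roots n. c x * pr (root_rep q (snd x) (fst x)) p) = 0)"
    unfolding T01_eq by (auto simp: s)
  also have "\<dots> \<longleftrightarrow> (\<forall>(i, j)\<in>pos_roots n. pr (root_rep q j i) p = 0)" (is "?l \<longleftrightarrow> ?r")
  proof
    assume l: ?l
    show ?r
    proof clarify
      fix i j assume ij: "(i, j) \<in> pos_roots n"
      have "0 = (\<Sum>x\<in>pos_roots n. of_bool (x = (i, j)) * pr (root_rep q (snd x) (fst x)) p)"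
        using l by metis
      also have "\<dots> = (\<Sum>x\<in>pos_roots n. if x = (i, j) then pr (root_rep q j i) p else 0)"
        by (rule sum.cong) auto
      also have "\<dots> = pr (root_rep q j i) p" using ij finite_pos_roots by simp
      finally show "pr (root_rep q j i) p = 0" by simp
    qed
  qed (auto intro!: sum.neutral)
  finally show ?thesis
    using p by (auto simp: I01_def O_plus_def O_counit_cls O.cls_closed)
qed

lemma I01_subset: "I01 n q P \<subseteq> carrier (Oq n q)"
  by (auto simp: I01_def O_plus_def)

text \<open>In the Leibniz rule, every functional on the right is \<open>\<epsilon>\<close> or one of the root functionals with a
  positive root as index.\<close>

lemma I01_mult_gen:
  assumes p: "p \<in> O_free n" "O_cls n q p \<in> I01 n q P" and kl: "(k, l) \<in> O_gens n"
  shows "O_cls n q (p * gen (k, l)) \<in> I01 n q P"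
proof -
  have p0: "pr 1 p = 0" "\<And>i j. (i, j) \<in> pos_roots n \<Longrightarrow> pr (root_rep q j i) p = 0"
    using p I01_iff by auto
  have "pr (root_rep q j i) (p * gen (k, l)) = 0" if ij: "(i, j) \<in> pos_roots n" for i j
  proof -
    have "i < l \<and> l < j \<longrightarrow> (i, l) \<in> pos_roots n" using ij by (auto simp: pos_roots_def)
    then show ?thesis unfolding pr_root_snoc[OF ij p(1) kl] using p0 ij by auto
  qed
  then show ?thesis
    using p0 p(1) kl by (subst I01_iff) (auto simp: pr_one_snoc free_alg_closed)
qed

lemma I01_right_ideal: "right_ideal (I01 n q P) (Oq n q)"
  unfolding right_ideal_def
proof (intro conjI ballI)
  have closed: "O_cls n q (p + r) \<in> I01 n q P" "O_cls n q (const c * p) \<in> I01 n q P"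
    if "p \<in> O_free n" "r \<in> O_free n" "O_cls n q p \<in> I01 n q P" "O_cls n q r \<in> I01 n q P" for p r c
    using that by (fastforce simp: I01_iff free_alg_closed pr_add_right pr_smult_right root_closed)+
  have zero: "O_cls n q 0 \<in> I01 n q P"
    by (auto simp: I01_iff free_alg_closed root_closed)
  show "additive_subgroup (I01 n q P) (Oq n q)"
  proof (rule additive_subgroupI, rule O.pres.add.subgroupI)
    fix a assume a: "a \<in> I01 n q P"
    then obtain p where p: "a = O_cls n q p" "p \<in> O_free n" using I01_subset O_carrier by blast
    have "O_cls n q (const (-1) * p) \<in> I01 n q P" using closed(2) p a by auto
    then show "\<ominus>\<^bsub>Oq n q\<^esub> a \<in> I01 n q P"
      using p by (simp add: const_uminus O.cls_uminus)
    fix b assume b: "b \<in> I01 n q P"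
    then obtain r where r: "b = O_cls n q r" "r \<in> O_free n" using I01_subset O_carrier by blast
    then show "a \<oplus>\<^bsub>Oq n q\<^esub> b \<in> I01 n q P"
      using closed(1)[of p r] p a b by (simp add: O.cls_add)
  qed (use I01_subset zero in auto)
  fix a x assume a: "a \<in> I01 n q P" and x: "x \<in> carrier (Oq n q)"
  obtain p where p: "a = O_cls n q p" "p \<in> O_free n" using a I01_subset O_carrier by blast
  obtain r where r: "x = O_cls n q r" "r \<in> O_free n" using x O_carrier by blast
  have "O_cls n q (p * r) \<in> I01 n q P" using r(2)
  proof (induction r rule: free_alg_induct)
    case (snoc r g)
    then show ?case
      using I01_mult_gen[of "p * r" "fst g" "snd g"] p
      by (cases g) (simp add: mult.assoc mult_in_free_alg)
  next
    case (add r s)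
    then show ?case using closed(1)[of "p * r" "p * s"] p by (simp add: distrib_left mult_in_free_alg)
  next
    case (smult c r)
    then show ?case using closed(2)[of "p * r" "p * r" c] p
      by (simp add: mult_in_free_alg const_commute mult.assoc)
  qed (use a p in auto)
  then show "a \<otimes>\<^bsub>Oq n q\<^esub> x \<in> I01 n q P" using p r by (simp add: O.cls_mult)
qed

lemma minus_linear_part_in_I01:
  assumes "p \<in> O_free n"
  shows "O_cls n q (p - linear_part p) \<in> I01 n q P"
  using assms pr_linear_part[OF assms]
  by (auto simp: I01_iff free_alg_closed linear_part_closed pr_diff_right root_closed)

lemma linear_part_zero_iff:
  assumes "p \<in> O_free n" "O_cls n q p \<in> I01 n q P"
  shows "linear_part p = 0"
  using assms I01_iff linear_part_eqI[of p 0 "\<lambda>_. 0"] by auto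

lemma linear_part_gen:
  assumes kl: "(k, l) \<in> O_gens n"
  shows "linear_part (gen (k, l)) = (if k = l then 1 else if l < k then gen (k, l) else 0)"
proof (cases "l < k")
  case True
  have "(l, k) \<in> pos_roots n" using True kl by (auto simp: pos_roots_def O_gens_def)
  then show ?thesis
    using linear_part_single[of "gen (k, l)" 0 l k 1] True kl pr_root_gen[OF _ kl] pr_one_gen[OF kl]
    by (auto simp: of_bool_def)
next
  case False
  then have "pr (root_rep q j i) (gen (k, l)) = 0" if "(i, j) \<in> pos_roots n" for i j
    using that pr_root_gen[OF that kl] pos_rootsD[OF that] by auto
  then show ?thesis
    using linear_part_eqI[of "gen (k, l)" "of_bool (k = l)" "\<lambda>_. 0"] False pr_one_gen[OF kl] by auto
qed

lemma linear_part_gen_gen: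
  assumes ij: "(i, j) \<in> pos_roots n" and kl: "(k, l) \<in> O_gens n"
  shows "linear_part (gen (j, i) * gen (k, l)) =
    (if k = l then const (cq q (of_bool (j = k) - of_bool (i = k))) * gen (j, i)
     else if l = j \<and> j < k then const (cq q 1 - cq q (-1)) * gen (k, i) else 0)"
proof -
  let ?p = "gen (j, i) * gen (k, l)"
  have ji: "(j, i) \<in> O_gens n" "gen (j, i) \<in> O_free n"
    using pos_root_gens[OF ij] by (auto intro: gen_in_free_alg)
  have eps: "pr 1 ?p = 0" "pr 1 (gen (j, i)) = 0"
    using pr_one_snoc[OF ji(2) kl] pr_one_gen[OF ji(1)] pos_rootsD[OF ij] by auto
  have root: "pr (root_rep q b a) ?p
    = of_bool (k = l) * cq q (of_bool (b = k) - of_bool (a = k)) * of_bool (j = b \<and> i = a)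
      + of_bool (k = b \<and> a < l \<and> l < b) * (cq q 1 - cq q (-1)) * of_bool (j = l \<and> i = a)"
    if ab: "(a, b) \<in> pos_roots n" for a b
  proof -
    have "pr (root_rep q l a) (gen (j, i)) = of_bool (j = l \<and> i = a)" if "a < l" "l < b"
      using that ab ji by (intro pr_root_gen) (auto simp: pos_roots_def)
    then show ?thesis
      unfolding pr_root_snoc[OF ab ji(2) kl] pr_root_gen[OF ab ji(1)] eps by auto
  qed
  consider "k = l" | "l = j" "j < k" | "k \<noteq> l" "\<not> (l = j \<and> j < k)" by blast
  then show ?thesis
  proof cases
    case 1
    have "linear_part ?p = const 0 + const (cq q (of_bool (j = k) - of_bool (i = k))) * gen (j, i)"
      by (rule linear_part_single[OF eps(1) ij]) (use root 1 in \<open>auto simp: of_bool_def\<close>)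
    then show ?thesis using 1 by simp
  next
    case 2
    then have "(i, k) \<in> pos_roots n" using ij kl by (auto simp: pos_roots_def O_gens_def)
    then have "linear_part ?p = const 0 + const (cq q 1 - cq q (-1)) * gen (k, i)"
      by (rule linear_part_single[OF eps(1)]) (use root 2 pos_rootsD[OF ij] in \<open>auto simp: of_bool_def\<close>)
    then show ?thesis using 2 by simp
  next
    case 3
    then show ?thesis
      using linear_part_eqI[OF eps(1), of "\<lambda>_. 0"] root pos_rootsD[OF ij] by auto
  qed
qed

end

section \<open>The generating set\<close>

context quantum_pairing
begin

lemma u_eq: "u n q i j = O_cls n q (gen (i, j))"
  by (simp add: u_def)

lemma O_rels_instances:
  assumes "{i, i', j, j'} \<subseteq> {1..n+1}"
  shows "i < i' \<Longrightarrow> gen (i, j) * gen (i', j) - const (cq q 1) * (gen (i', j) * gen (i, j)) \<in> O_rels n q"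
    and "j < j' \<Longrightarrow> gen (i, j) * gen (i, j') - const (cq q 1) * (gen (i, j') * gen (i, j)) \<in> O_rels n q"
    and "i < i' \<Longrightarrow> j < j' \<Longrightarrow> gen (i, j') * gen (i', j) - gen (i', j) * gen (i, j') \<in> O_rels n q"
    and "i < i' \<Longrightarrow> j < j' \<Longrightarrow> gen (i, j) * gen (i', j') - gen (i', j') * gen (i, j)
      - const (cq q 1 - cq q (-1)) * (gen (i, j') * gen (i', j)) \<in> O_rels n q"
proof -
  have w: "gen a * gen b = word [a, b]" for a b :: ogen
    by (simp add: gen_def flip: word_append)
  show "i < i' \<Longrightarrow> gen (i, j) * gen (i', j) - const (cq q 1) * (gen (i', j) * gen (i, j)) \<in> O_rels n q"
    unfolding O_rels_def w
    by (insert assms, rule UnI1, rule UnI1, rule UnI1, rule UnI1,  rule CollectI, rule exI[of _ i], rule exI[of _ i'], rule exI[of _ j],  simp)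
  show "j < j' \<Longrightarrow> gen (i, j) * gen (i, j') - const (cq q 1) * (gen (i, j') * gen (i, j)) \<in> O_rels n q"
    unfolding O_rels_def w
    by (insert assms, rule UnI1, rule UnI1, rule UnI1, rule UnI2,  rule CollectI, rule exI[of _ i], rule exI[of _ j], rule exI[of _ j'],  simp)
  show "i < i' \<Longrightarrow> j < j' \<Longrightarrow> gen (i, j') * gen (i', j) - gen (i', j) * gen (i, j') \<in> O_rels n q"
    unfolding O_rels_def w
    by (insert assms, rule UnI1, rule UnI1, rule UnI2,  rule CollectI, rule exI[of _ i], rule exI[of _ i'], rule exI[of _ j], rule exI[of _ j'],  simp)
  show "i < i' \<Longrightarrow> j < j' \<Longrightarrow> gen (i, j) * gen (i', j') - gen (i', j') * gen (i, j)
      - const (cq q 1 - cq q (-1)) * (gen (i, j') * gen (i', j)) \<in> O_rels n q"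
    unfolding O_rels_def w
    by (insert assms, rule UnI1, rule UnI2,  rule CollectI, rule exI[of _ i], rule exI[of _ i'], rule exI[of _ j], rule exI[of _ j'],  simp)
qed

text \<open>Let \<open>W\<close> consist of the elements that agree with their linear part modulo \<open>J\<close>. It suffices that
  \<open>W\<close> is closed under right multiplication by a generator. The difference of an element of \<open>W\<close> from
  its linear part lies in \<open>J\<close> by definition and in \<open>I01\<close> by duality; both are right ideals, so
  after multiplication it still lies in \<open>J\<close> and still has linear part zero. What remains are the products of
  the generators with \<open>1\<close> and with the dual basis.\<close>

lemma I01_least:
  assumes J: "right_ideal J (Oq n q)" and G: "G1 n q \<union> G2 n q \<union> G3 n q \<subseteq> J"
  shows "I01 n q P \<subseteq> J"
proof -
  interpret J: additive_subgroup J "Oq n q" using J by (simp add: right_ideal_def)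
  define Jp where "Jp = {p \<in> O_free n. O_cls n q p \<in> J}"
  have free: "p \<in> O_free n" if "p \<in> Jp" for p using that by (simp add: Jp_def)
  have g: "gen (k, l) \<in> O_free n" if "k \<in> {1..n+1}" "l \<in> {1..n+1}" for k l
    using that by (auto intro: gen_in_free_alg simp: O_gens_def)
  have mult: "p * r \<in> Jp" if "p \<in> Jp" "r \<in> O_free n" for p r
    using that J by (auto simp: Jp_def right_ideal_def O.cls_mult mult_in_free_alg O.cls_closed)
  have add: "p + r \<in> Jp" if "p \<in> Jp" "r \<in> Jp" for p r
    using that by (auto simp: Jp_def O.cls_add add_in_free_alg)
  \<comment> \<open>Scalars are central, so a right ideal is a subspace.\<close>
  have smult: "const c * p \<in> Jp" if "p \<in> Jp" for c p
    using mult[OF that const_in_free_alg] by (simp add: const_commute)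
  have diff: "p - r \<in> Jp" if "p \<in> Jp" "r \<in> Jp" for p r
    using add[OF that(1) smult[OF that(2), of "-1"]] by (simp add: const_uminus)
  have zero: "0 \<in> Jp" by (simp add: Jp_def zero_in_free_alg O.cls_zero)
  have rel: "p \<in> Jp" if "p \<in> O_rels n q" for p
    using that O.rels by (auto simp: Jp_def cls_eq_zero_rel)
  have upper: "gen (i, j) \<in> Jp" if "(i, j) \<in> pos_roots n" for i j
    using that G pos_root_gens[OF that] by (auto simp: Jp_def G1_def u_eq gen_in_free_alg)
  have diag: "gen (k, k) - 1 \<in> Jp" if "k \<in> {1..n+1}" for k
  proof -
    have "u n q k k \<ominus>\<^bsub>Oq n q\<^esub> \<one>\<^bsub>Oq n q\<^esub> \<in> J" using G that unfolding G1_def by blast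
    then show ?thesis
      using g[OF that that] by (simp add: Jp_def u_eq O.cls_diff O.cls_one one_in_free_alg diff_in_free_alg)
  qed
  have prod: "gen (j, i) * gen (k, l) \<in> Jp"
    if ij: "(i, j) \<in> pos_roots n" and kl: "(k, l) \<in> pos_roots n \<or> (l, k) \<in> pos_roots n \<and> j \<noteq> l" for i j k l
  proof -
    have "u n q j i \<otimes>\<^bsub>Oq n q\<^esub> u n q k l \<in> G2 n q \<union> G3 n q"
      using ij kl unfolding G2_def G3_def by blast
    moreover have "gen (j, i) \<in> O_free n" "gen (k, l) \<in> O_free n"
      using ij kl by (auto intro!: gen_in_free_alg dest: pos_root_gens)
    ultimately show ?thesis
      using G by (auto simp: Jp_def u_eq mult_in_free_alg O.cls_mult)
  qed
  have cqs: "const (cq q (-1)) * (const (cq q 1) * p) = p" for p :: "ogen falg"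
    using cq_add[OF q_nonzero, of "-1" 1] by (simp flip: const_mult mult.assoc)
  \<comment> \<open>The products in \<open>G2\<close> and \<open>G3\<close> lie in \<open>J\<close> and have linear part zero. In the remaining cases
    \<open>k = l\<close> and \<open>l = j < k\<close> one quadratic relation moves the diagonal generator to the left, where it may be
    replaced by \<open>1\<close>; the correction terms begin with a generator above the diagonal or belong to \<open>G3\<close>.\<close>
  have straighten: "gen (j, i) * gen (k, l) - linear_part (gen (j, i) * gen (k, l)) \<in> Jp"
    if ij: "(i, j) \<in> pos_roots n" and kl: "(k, l) \<in> O_gens n" for i j k l
  proof -
    have b: "i \<in> {1..n+1}" "j \<in> {1..n+1}" "i < j" "k \<in> {1..n+1}" "l \<in> {1..n+1}"
      using ij kl by (auto simp: pos_roots_def O_gens_def)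
    have root: "(x, y) \<in> pos_roots n \<longleftrightarrow> x < y" if "x \<in> {i, j, k, l}" "y \<in> {i, j, k, l}" for x y
      using that b by (auto simp: pos_roots_def)
    let ?\<nu> = "cq q 1 - cq q (-1)"
    have dg: "(gen (k, k) - 1) * gen (j, i) \<in> Jp"
      using mult[OF diag[OF b(4)] g[OF b(2,1)]] .
    consider "k < l" | "l < k" "j \<noteq> l" | "l < k" "l = j" | "k = l" "k = j" | "k = l" "k = i"
      | "k = l" "k < i" | "k = l" "i < k" "k < j" | "k = l" "j < k"
      by linarith
    then show ?thesis
    proof cases
      case 1
      then show ?thesis using prod[OF ij] root linear_part_gen_gen[OF ij kl] by auto
    next
      case 2
      then show ?thesis using prod[OF ij] root linear_part_gen_gen[OF ij kl] by auto
    next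
      case 3
      let ?r = "gen (j, i) * gen (k, j) - gen (k, j) * gen (j, i) - const ?\<nu> * (gen (j, j) * gen (k, i))"
      have "?r + gen (k, j) * gen (j, i) + const ?\<nu> * ((gen (j, j) - 1) * gen (k, i)) \<in> Jp"
        using b 3 root by (intro add[OF add[OF rel prod]] smult mult[OF diag g] O_rels_instances(4)) auto
      then show ?thesis
        using 3 linear_part_gen_gen[OF ij kl] by (simp add: algebra_simps)
    next
      case 4
      let ?r = "gen (j, i) * gen (j, j) - const (cq q 1) * (gen (j, j) * gen (j, i))"
      have "?r + const (cq q 1) * ((gen (k, k) - 1) * gen (j, i)) \<in> Jp"
        using b 4 by (intro add[OF rel smult[OF dg]] O_rels_instances(2)) auto
      then show ?thesis
        using 4 b linear_part_gen_gen[OF ij kl] by (simp add: algebra_simps)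
    next
      case 5
      let ?r = "gen (i, i) * gen (j, i) - const (cq q 1) * (gen (j, i) * gen (i, i))"
      have "const (cq q (-1)) * ((gen (k, k) - 1) * gen (j, i) - ?r) \<in> Jp"
        using b 5 by (intro smult diff[OF dg rel] O_rels_instances(1)) auto
      then show ?thesis
        using 5 b linear_part_gen_gen[OF ij kl] by (simp add: algebra_simps cqs)
    next
      case 6
      let ?r = "gen (k, k) * gen (j, i) - gen (j, i) * gen (k, k) - const ?\<nu> * (gen (k, i) * gen (j, k))"
      have "(gen (k, k) - 1) * gen (j, i) - ?r - const ?\<nu> * (gen (k, i) * gen (j, k)) \<in> Jp"
        using b 6 root by (intro diff[OF diff[OF dg rel]] smult mult[OF upper g] O_rels_instances(4)) auto
      then show ?thesis
        using 6 b linear_part_gen_gen[OF ij kl] by (simp add: algebra_simps)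
    next
      case 7
      let ?r = "gen (k, k) * gen (j, i) - gen (j, i) * gen (k, k)"
      have "(gen (k, k) - 1) * gen (j, i) - ?r \<in> Jp"
        using b 7 by (intro diff[OF dg rel] O_rels_instances(3)) auto
      then show ?thesis
        using 7 b linear_part_gen_gen[OF ij kl] by (simp add: algebra_simps)
    next
      case 8
      let ?r = "gen (j, i) * gen (k, k) - gen (k, k) * gen (j, i) - const ?\<nu> * (gen (j, k) * gen (k, i))"
      have "?r + (gen (k, k) - 1) * gen (j, i) + const ?\<nu> * (gen (j, k) * gen (k, i)) \<in> Jp"
        using b 8 root by (intro add[OF add[OF rel dg]] smult mult[OF upper g] O_rels_instances(4)) auto
      then show ?thesis
        using 8 b linear_part_gen_gen[OF ij kl] by (simp add: algebra_simps)
    qed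
  qed
  define W where "W = {p \<in> O_free n. p - linear_part p \<in> Jp}"
  have W_add: "p + r \<in> W" if "p \<in> W" "r \<in> W" for p r
    using that add[of "p - linear_part p" "r - linear_part r"]
    by (simp add: W_def add_in_free_alg linear_part_add algebra_simps)
  have W_smult: "const c * p \<in> W" if "p \<in> W" for c p
    using that smult[of "p - linear_part p" c]
    by (simp add: W_def mult_in_free_alg const_in_free_alg linear_part_smult right_diff_distrib)
  have W_zero: "0 \<in> W"
    using linear_part_smult[OF zero_in_free_alg, of 0] by (simp add: W_def zero_in_free_alg zero)
  have W_sum: "sum f A \<in> W" if "\<And>a. a \<in> A \<Longrightarrow> f a \<in> W" for f and A :: "(nat \<times> nat) set"
    using that by (induction A rule: infinite_finite_induct) (simp_all add: W_add W_zero)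
  have W_gen: "gen (k, l) \<in> W" if kl: "(k, l) \<in> O_gens n" for k l
  proof -
    have kl': "k \<in> {1..n+1}" "l \<in> {1..n+1}" using kl by (auto simp: O_gens_def)
    consider "k = l" | "l < k" | "k < l" by linarith
    then show ?thesis
      by cases (use linear_part_gen[OF kl] diag[OF kl'(1)] upper[of k l] kl' zero gen_in_free_alg[OF kl]
        in \<open>auto simp: W_def pos_roots_def\<close>)
  qed
  have W_all: "p \<in> W" if "p \<in> O_free n" for p
    using that
  proof (induction p rule: free_alg_induct)
    case one
    have "linear_part 1 = const 1 + (\<Sum>x\<in>pos_roots n. const 0 * gen (snd x, fst x))"
      by (rule linear_part_eqI) (use pr_root_one pos_rootsD in auto)
    then show ?case by (simp add: W_def one_in_free_alg zero)
  next
    case (snoc p x)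
    obtain k l where x: "x = (k, l)" by (cases x)
    let ?g = "gen (k, l)" and ?j = "p - linear_part p"
    have kl: "(k, l) \<in> O_gens n" and gf: "?g \<in> O_free n" using snoc x by (auto intro: gen_in_free_alg)
    have j: "?j \<in> Jp" using snoc by (simp add: W_def)
    have "linear_part (?j * ?g) = 0"
      using I01_mult_gen[OF _ minus_linear_part_in_I01 kl] snoc(1) free[OF j]
      by (intro linear_part_zero_iff mult_in_free_alg gf)
    then have 1: "?j * ?g \<in> W"
      using mult[OF j gf] by (simp add: W_def free)
    have "gen (snd y, fst y) * ?g \<in> W" if "y \<in> pos_roots n" for y
      using that straighten[of "fst y" "snd y" k l] kl gf pos_root_gens[of "fst y" "snd y"]
      by (auto simp: W_def intro!: mult_in_free_alg gen_in_free_alg)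
    then have 2: "const (pr 1 p) * ?g
      + (\<Sum>y\<in>pos_roots n. const (pr (root_rep q (snd y) (fst y)) p) * (gen (snd y, fst y) * ?g)) \<in> W"
      by (intro W_add W_smult W_sum W_gen kl)
    have "p * ?g = ?j * ?g + (const (pr 1 p) * ?g
      + (\<Sum>y\<in>pos_roots n. const (pr (root_rep q (snd y) (fst y)) p) * (gen (snd y, fst y) * ?g)))"
      by (simp add: linear_part_def algebra_simps sum_distrib_left sum_distrib_right)
    then show ?case using W_add[OF 1 2] x by simp
  qed (auto intro: W_add W_smult)
  show ?thesis
  proof
    fix a assume a: "a \<in> I01 n q P"
    then obtain p where p: "a = O_cls n q p" "p \<in> O_free n" using I01_subset O_carrier by blast
    then show "a \<in> J"
      using W_all[OF p(2)] linear_part_zero_iff[OF p(2)] a by (simp add: W_def Jp_def)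
  qed
qed

lemma G_subset_I01: "G1 n q \<union> G2 n q \<union> G3 n q \<subseteq> I01 n q P"
proof -
  have *: "O_cls n q p \<in> I01 n q P" if "p \<in> O_free n" "linear_part p = 0" for p
    using minus_linear_part_in_I01[OF that(1)] that by simp
  have prod: "u n q j i \<otimes>\<^bsub>Oq n q\<^esub> u n q k l \<in> I01 n q P"
    if ij: "(i, j) \<in> pos_roots n" and kl: "(k, l) \<in> O_gens n" "k < l \<or> l < k \<and> l \<noteq> j" for i j k l
  proof -
    have "gen (j, i) \<in> O_free n" "gen (k, l) \<in> O_free n"
      using pos_root_gens[OF ij] kl by (auto intro!: gen_in_free_alg)
    moreover have "linear_part (gen (j, i) * gen (k, l)) = 0"
      using linear_part_gen_gen[OF ij kl(1)] kl(2) pos_rootsD[OF ij] by auto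
    ultimately show ?thesis
      by (simp add: u_eq mult_in_free_alg * flip: O.cls_mult)
  qed
  have "u n q i j \<in> I01 n q P" if "(i, j) \<in> pos_roots n" for i j
    unfolding u_eq using that pos_root_gens[OF that] pos_rootsD[OF that]
    by (intro *) (auto simp: gen_in_free_alg linear_part_gen)
  moreover have "u n q k k \<ominus>\<^bsub>Oq n q\<^esub> \<one>\<^bsub>Oq n q\<^esub> \<in> I01 n q P" if "k \<in> {1..n+1}" for k
  proof -
    have k: "(k, k) \<in> O_gens n" "gen (k, k) \<in> O_free n"
      using that by (auto simp: O_gens_def intro!: gen_in_free_alg)
    have "O_cls n q (gen (k, k) - 1) \<in> I01 n q P"
      using minus_linear_part_in_I01[OF k(2)] linear_part_gen[OF k(1)] by simp
    then show ?thesis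
      using k(2) by (simp add: u_eq O.cls_diff O.cls_one one_in_free_alg)
  qed
  moreover have "G2 n q \<subseteq> I01 n q P"
    unfolding G2_def using prod pos_root_gens pos_rootsD by fastforce
  moreover have "G3 n q \<subseteq> I01 n q P"
    unfolding G3_def using prod pos_root_gens pos_rootsD by fastforce
  ultimately show ?thesis unfolding G1_def by blast
qed

lemma I01_generated: "I01 n q P = gen_right_ideal (Oq n q) (G1 n q \<union> G2 n q \<union> G3 n q)"
  unfolding gen_right_ideal_def using I01_least I01_right_ideal G_subset_I01 by blast

end

section \<open>The quotient module\<close>

context quantum_pairing
begin

sublocale I: abelian_subgroup "I01 n q P" "Oq n q"
  using I01_right_ideal
  by (intro abelian_subgroupI3 O.pres.abelian_group_axioms) (auto simp: right_ideal_def)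

definition lam :: "ogen falg \<Rightarrow> ogen falg set set" where
  "lam p = Lam_cls n q P (O_cls n q p)"

lemma lam_eq_iff:
  assumes "p \<in> O_free n" "r \<in> O_free n"
  shows "lam p = lam r \<longleftrightarrow> O_cls n q (p - r) \<in> I01 n q P"
proof
  have c: "O_cls n q p \<in> carrier (Oq n q)" "O_cls n q r \<in> carrier (Oq n q)"
    using assms by (auto intro: O.cls_closed)
  note m = I.a_rcos_module_minus[OF O.pres.ring_axioms c(2,1)]
  assume "lam p = lam r"
  then have "O_cls n q p \<in> I01 n q P +>\<^bsub>Oq n q\<^esub> O_cls n q r"
    using I.a_rcos_self[OF c(1)] by (simp add: lam_def Lam_cls_def)
  then show "O_cls n q (p - r) \<in> I01 n q P" using m assms by (simp add: O.cls_diff)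
next
  have c: "O_cls n q p \<in> carrier (Oq n q)" "O_cls n q r \<in> carrier (Oq n q)"
    using assms by (auto intro: O.cls_closed)
  assume "O_cls n q (p - r) \<in> I01 n q P"
  then have "O_cls n q p \<in> I01 n q P +>\<^bsub>Oq n q\<^esub> O_cls n q r"
    using I.a_rcos_module_minus[OF O.pres.ring_axioms c(2,1)] assms by (simp add: O.cls_diff)
  then show "lam p = lam r"
    using I.a_repr_independence'[OF _ c(2)] by (simp add: lam_def Lam_cls_def)
qed

lemma lam_elem:
  assumes "x \<in> lam p" "p \<in> O_free n"
  obtains r where "r \<in> O_free n" "x = O_cls n q r" "O_cls n q (r - p) \<in> I01 n q P"
proof -
  have c: "O_cls n q p \<in> carrier (Oq n q)" using assms by (auto intro: O.cls_closed)
  have "x \<in> carrier (Oq n q)"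
    using assms(1) I.a_elemrcos_carrier[OF c] by (simp add: lam_def Lam_cls_def)
  then obtain r where r: "r \<in> O_free n" "x = O_cls n q r" using O_carrier by blast
  moreover have "O_cls n q (r - p) \<in> I01 n q P"
    using I.a_rcos_module_minus[OF O.pres.ring_axioms c, of x] r assms O.cls_closed[OF r(1)]
    by (simp add: lam_def Lam_cls_def O.cls_diff)
  ultimately show thesis by (rule that)
qed

lemma lam_self: "p \<in> O_free n \<Longrightarrow> O_cls n q p \<in> lam p"
  unfolding lam_def Lam_cls_def by (intro I.a_rcos_self O.cls_closed)

lemma lam_linear_part: "p \<in> O_free n \<Longrightarrow> lam p = lam (linear_part p)"
  by (simp add: lam_eq_iff linear_part_closed minus_linear_part_in_I01)

lemma Lam_carrier: "carrier (Lam n q P) = lam ` {p \<in> O_free n. pr 1 p = 0}"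
  by (auto simp: Lam_def O_plus_def O_carrier O_counit_cls lam_def)

lemma Lam_zero: "\<zero>\<^bsub>Lam n q P\<^esub> = lam 0"
  by (simp add: Lam_def lam_def Lam_cls_def O.cls_zero I.a_rcos_const)

lemma Lam_add: "p \<in> O_free n \<Longrightarrow> r \<in> O_free n \<Longrightarrow> lam p \<oplus>\<^bsub>Lam n q P\<^esub> lam r = lam (p + r)"
  by (simp add: Lam_def lam_def Lam_cls_def O.cls_add I.a_rcos_sum O.cls_closed)

text \<open>Both operations on cosets are unions over all representatives; they are computed on any single
  one because all representatives give the same coset.\<close>

lemma Lam_smult:
  assumes p: "p \<in> O_free n"
  shows "c \<odot>\<^bsub>Lam n q P\<^esub> lam p = lam (const c * p)"
proof -
  have "Lam_cls n q P (c \<odot>\<^bsub>Oq n q\<^esub> x) = lam (const c * p)" if x: "x \<in> lam p" for x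
  proof -
    obtain r where r: "r \<in> O_free n" "x = O_cls n q r" "O_cls n q (r - p) \<in> I01 n q P"
      using lam_elem[OF x p] .
    have "O_cls n q ((r - p) * const c) \<in> I01 n q P"
      using I01_right_ideal r p O.cls_closed[OF const_in_free_alg, of c]
      by (simp add: right_ideal_def O.cls_mult diff_in_free_alg const_in_free_alg)
    then have "lam (const c * r) = lam (const c * p)"
      using r p by (simp add: lam_eq_iff mult_in_free_alg const_in_free_alg const_commute left_diff_distrib)
    then show ?thesis using r by (simp add: lam_def O.cls_smult)
  qed
  then show ?thesis
    using lam_self[OF p] by (auto simp: Lam_def)
qed

lemma Lam_act_lam:
  assumes p: "p \<in> O_free n" and a: "a \<in> O_free n"
  shows "Lam_act n q P (lam p) (O_cls n q a) = lam (p * a)"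
proof -
  have "Lam_cls n q P (x \<otimes>\<^bsub>Oq n q\<^esub> O_cls n q a) = lam (p * a)" if x: "x \<in> lam p" for x
  proof -
    obtain r where r: "r \<in> O_free n" "x = O_cls n q r" "O_cls n q (r - p) \<in> I01 n q P"
      using lam_elem[OF x p] .
    have "O_cls n q ((r - p) * a) \<in> I01 n q P"
      using I01_right_ideal r p a O.cls_closed[OF a]
      by (simp add: right_ideal_def O.cls_mult diff_in_free_alg)
    then have "lam (r * a) = lam (p * a)"
      using r p a by (simp add: lam_eq_iff mult_in_free_alg left_diff_distrib)
    then show ?thesis using r a by (simp add: lam_def O.cls_mult)
  qed
  then show ?thesis
    using lam_self[OF p] by (auto simp: Lam_act_def)
qed

lemma e01_eq: "e01 n q P j i = lam (gen (j, i))"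
  by (simp add: e01_def lam_def u_eq)

lemma Lam_abelian_monoid: "abelian_monoid (Lam n q P)"
proof (rule abelian_monoidI)
  show "\<zero>\<^bsub>Lam n q P\<^esub> \<in> carrier (Lam n q P)"
    by (simp add: Lam_zero Lam_carrier zero_in_free_alg one_in_free_alg)
qed (auto simp: Lam_carrier Lam_add Lam_zero add_in_free_alg zero_in_free_alg pr_add_right
    one_in_free_alg ac_simps)

lemma Lam_sum:
  assumes "finite A" "\<And>a. a \<in> A \<Longrightarrow> f a \<in> O_free n" "\<And>a. a \<in> A \<Longrightarrow> pr 1 (f a) = 0"
  shows "(\<Oplus>\<^bsub>Lam n q P\<^esub>a\<in>A. lam (f a)) = lam (sum f A)"
proof -
  interpret Lam: abelian_monoid "Lam n q P" by (rule Lam_abelian_monoid)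
  show ?thesis using assms
  proof (induction A rule: finite_induct)
    case (insert a A)
    then have "(\<lambda>a. lam (f a)) \<in> A \<rightarrow> carrier (Lam n q P)" "lam (f a) \<in> carrier (Lam n q P)"
      by (auto simp: Lam_carrier)
    then show ?case
      using insert by (simp add: Lam_add sum_in_free_alg)
  qed (simp add: Lam_zero)
qed

lemma Lam_combination:
  "(\<Oplus>\<^bsub>Lam n q P\<^esub>x\<in>pos_roots n. c x \<odot>\<^bsub>Lam n q P\<^esub> e01 n q P (snd x) (fst x))
    = lam (\<Sum>x\<in>pos_roots n. const (c x) * gen (snd x, fst x))"
proof -
  interpret Lam: abelian_monoid "Lam n q P" by (rule Lam_abelian_monoid)
  have g: "gen (snd x, fst x) \<in> O_free n" "pr 1 (gen (snd x, fst x)) = 0" if "x \<in> pos_roots n" for x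
    using that pos_root_gens[of "fst x" "snd x"] pos_rootsD[of "fst x" "snd x"] pr_one_gen[of "snd x" "fst x"]
    by (auto intro: gen_in_free_alg)
  have *: "const (c x) * gen (snd x, fst x) \<in> O_free n" "pr 1 (const (c x) * gen (snd x, fst x)) = 0"
    if "x \<in> pos_roots n" for x
    using g[OF that] by (simp_all add: mult_in_free_alg const_in_free_alg pr_smult_right one_in_free_alg)
  have "(\<Oplus>\<^bsub>Lam n q P\<^esub>x\<in>pos_roots n. c x \<odot>\<^bsub>Lam n q P\<^esub> e01 n q P (snd x) (fst x))
    = (\<Oplus>\<^bsub>Lam n q P\<^esub>x\<in>pos_roots n. lam (const (c x) * gen (snd x, fst x)))"
    by (rule Lam.finsum_cong') (use * g in \<open>auto simp: Lam_carrier e01_eq Lam_smult\<close>)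
  then show ?thesis
    using Lam_sum[OF finite_pos_roots, of "\<lambda>x. const (c x) * gen (snd x, fst x)"] * by simp
qed

lemma Lam_basis_e01: "Lam_basis n q P"
  unfolding Lam_basis_def Lam_combination
proof (intro conjI ballI)
  fix x assume "x \<in> pos_roots n"
  then obtain i j where x: "x = (i, j)" "(i, j) \<in> pos_roots n" by (cases x) auto
  then have "(j, i) \<in> O_gens n" "pr 1 (gen (j, i)) = 0"
    using pos_root_gens[OF x(2)] pr_one_gen[of j i] pos_rootsD[OF x(2)] by auto
  then show "case x of (i, j) \<Rightarrow> e01 n q P j i \<in> carrier (Lam n q P)"
    unfolding x by (simp add: e01_eq Lam_carrier gen_in_free_alg)
next
  fix M assume "M \<in> carrier (Lam n q P)"
  then obtain p where p: "p \<in> O_free n" "pr 1 p = 0" "M = lam p" by (auto simp: Lam_carrier)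
  let ?s = "\<lambda>c. \<Sum>x\<in>pos_roots n. const (c x) * gen (snd x, fst x)"
  define d where "d = restrict (\<lambda>x. pr (root_rep q (snd x) (fst x)) p) (pos_roots n)"
  show "\<exists>!c. c \<in> pos_roots n \<rightarrow>\<^sub>E UNIV \<and> M = lam (?s c)"
  proof (rule ex1I[of _ d])
    have "linear_part p = ?s d"
      unfolding linear_part_def d_def using p(2) by (auto intro!: sum.cong)
    then show "d \<in> pos_roots n \<rightarrow>\<^sub>E UNIV \<and> M = lam (?s d)"
      using p lam_linear_part by (auto simp: d_def)
  next
    fix c assume c: "c \<in> pos_roots n \<rightarrow>\<^sub>E UNIV \<and> M = lam (?s c)"
    then have "O_cls n q (p - ?s c) \<in> I01 n q P"
      using p lam_eq_iff root_sum_closed by auto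
    then have *: "\<forall>(i, j)\<in>pos_roots n. pr (root_rep q j i) (p - ?s c) = 0"
      using p root_sum_closed by (subst (asm) I01_iff) (auto intro: diff_in_free_alg)
    have "c (i, j) = d (i, j)" if ij: "(i, j) \<in> pos_roots n" for i j
    proof -
      have "pr (root_rep q j i) p - pr (root_rep q j i) (?s c) = 0"
        using * ij pr_diff_right[OF root_closed[OF ij] p(1) root_sum_closed, of c] by auto
      then show ?thesis using ij by (simp add: pr_root_sum d_def)
    qed
    then show "c = d"
      using c by (intro PiE_ext[of c "pos_roots n" "\<lambda>_. UNIV" d]) (auto simp: d_def)
  qed
qed

lemma e01_action:
  assumes ij: "(i, j) \<in> pos_roots n" and kl: "(k, l) \<in> O_gens n"
  shows "Lam_act n q P (e01 n q P j i) (u n q k l) = lam (linear_part (gen (j, i) * gen (k, l)))"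
proof -
  have "gen (j, i) \<in> O_free n" "gen (k, l) \<in> O_free n"
    using kl pos_root_gens[OF ij] by (auto intro: gen_in_free_alg)
  then show ?thesis
    by (simp add: e01_eq u_eq Lam_act_lam lam_linear_part[of "_ * _"] mult_in_free_alg)
qed

lemma smult_e01:
  assumes ij: "(i, j) \<in> pos_roots n"
  shows "lam (const c * gen (j, i)) = c \<odot>\<^bsub>Lam n q P\<^esub> e01 n q P j i"
    and "c \<noteq> 0 \<Longrightarrow> lam (const c * gen (j, i)) \<noteq> \<zero>\<^bsub>Lam n q P\<^esub>"
proof -
  have ji: "(j, i) \<in> O_gens n" "gen (j, i) \<in> O_free n"
    using pos_root_gens[OF ij] by (auto intro: gen_in_free_alg)
  show "lam (const c * gen (j, i)) = c \<odot>\<^bsub>Lam n q P\<^esub> e01 n q P j i"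
    using ji by (simp add: e01_eq Lam_smult)
  assume c: "c \<noteq> 0"
  have "pr (root_rep q j i) (const c * gen (j, i)) = c"
    using pr_smult_right[OF root_closed[OF ij] ji(2)] pr_root_gen[OF ij ji(1)] by simp
  then show "lam (const c * gen (j, i)) \<noteq> \<zero>\<^bsub>Lam n q P\<^esub>"
    using ij ji c by (auto simp: Lam_zero lam_eq_iff I01_iff mult_in_free_alg const_in_free_alg
        zero_in_free_alg intro!: bexI[of _ "(i, j)"])
qed

end

lemma cq_diff_nonzero:
  assumes "q \<noteq> -1" "q \<noteq> 0" "q \<noteq> 1"
  shows "cq q 1 - cq q (-1) \<noteq> 0"
proof
  assume "cq q 1 - cq q (-1) = 0"
  then have "complex_of_real q * complex_of_real q = 1"
    using assms(2) by (simp add: cq_def power_int_minus field_simps)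
  then have "q * q = 1"
    by (metis of_real_1 of_real_eq_iff of_real_mult)
  then have "(q - 1) * (q + 1) = 0" by (simp add: algebra_simps)
  then show False using assms by auto
qed

theorem proposition3p7:
  fixes n :: nat and q :: real
    and P :: "ugen falg set \<Rightarrow> ogen falg set \<Rightarrow> complex"
  assumes n: "1 \<le> n"
    and q: "q \<noteq> -1" "q \<noteq> 0" "q \<noteq> 1"
    and P: "evaluation_pairing n q P"
  shows
    "right_ideal (I01 n q P) (Oq n q) \<and>
     I01 n q P = gen_right_ideal (Oq n q) (G1 n q \<union> G2 n q \<union> G3 n q) \<and>
     Lam_basis n q P \<and>
     (\<forall>i j k. (i, j) \<in> pos_roots n \<and> k \<in> {1..n+1} \<longrightarrow>
        Lam_act n q P (e01 n q P j i) (u n q k k) =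
          cq q (of_bool (j = k) - of_bool (i = k)) \<odot>\<^bsub>Lam n q P\<^esub> e01 n q P j i \<and>
        Lam_act n q P (e01 n q P j i) (u n q k k) \<noteq> \<zero>\<^bsub>Lam n q P\<^esub>) \<and>
     (\<forall>i j j'. (i, j) \<in> pos_roots n \<and> (j, j') \<in> pos_roots n \<longrightarrow>
        Lam_act n q P (e01 n q P j i) (u n q j' j) =
          (cq q 1 - cq q (-1)) \<odot>\<^bsub>Lam n q P\<^esub> e01 n q P j' i \<and>
        Lam_act n q P (e01 n q P j i) (u n q j' j) \<noteq> \<zero>\<^bsub>Lam n q P\<^esub>) \<and>
     (\<forall>i j k l. (i, j) \<in> pos_roots n \<and> k \<in> {1..n+1} \<and> l \<in> {1..n+1} \<and>
        k \<noteq> l \<and> \<not> (l = j \<and> (j, k) \<in> pos_roots n) \<longrightarrow>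
        Lam_act n q P (e01 n q P j i) (u n q k l) = \<zero>\<^bsub>Lam n q P\<^esub>)"
proof -
  interpret quantum_pairing n q P
    using n q P by unfold_locales
  have scaled: "lam (const c * gen (j, i)) = c \<odot>\<^bsub>Lam n q P\<^esub> e01 n q P j i \<and>
      lam (const c * gen (j, i)) \<noteq> \<zero>\<^bsub>Lam n q P\<^esub>"
    if "(i, j) \<in> pos_roots n" "c \<noteq> 0" for i j c
    using smult_e01[OF that(1)] that(2) by blast
  have diagonal: "Lam_act n q P (e01 n q P j i) (u n q k k) =
        cq q (of_bool (j = k) - of_bool (i = k)) \<odot>\<^bsub>Lam n q P\<^esub> e01 n q P j i \<and>
      Lam_act n q P (e01 n q P j i) (u n q k k) \<noteq> \<zero>\<^bsub>Lam n q P\<^esub>"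
    if ij: "(i, j) \<in> pos_roots n" and k: "k \<in> {1..n+1}" for i j k
  proof -
    have kk: "(k, k) \<in> O_gens n" using k by (simp add: O_gens_def)
    have eq: "linear_part (gen (j, i) * gen (k, k))
        = const (cq q (of_bool (j = k) - of_bool (i = k))) * gen (j, i)"
      using linear_part_gen_gen[OF ij kk] by simp
    show ?thesis
      unfolding e01_action[OF ij kk] eq by (rule scaled[OF ij cq_nonzero[OF q(2)]])
  qed
  have shift: "Lam_act n q P (e01 n q P j i) (u n q j' j) =
        (cq q 1 - cq q (-1)) \<odot>\<^bsub>Lam n q P\<^esub> e01 n q P j' i \<and>
      Lam_act n q P (e01 n q P j i) (u n q j' j) \<noteq> \<zero>\<^bsub>Lam n q P\<^esub>"
    if ij: "(i, j) \<in> pos_roots n" and jj': "(j, j') \<in> pos_roots n" for i j j'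
  proof -
    have j'j: "(j', j) \<in> O_gens n" "(i, j') \<in> pos_roots n" "j < j'"
      using ij jj' by (auto simp: pos_roots_def O_gens_def)
    have eq: "linear_part (gen (j, i) * gen (j', j)) = const (cq q 1 - cq q (-1)) * gen (j', i)"
      using linear_part_gen_gen[OF ij j'j(1)] j'j(3) by simp
    show ?thesis
      unfolding e01_action[OF ij j'j(1)] eq by (rule scaled[OF j'j(2) cq_diff_nonzero[OF q]])
  qed
  have other: "Lam_act n q P (e01 n q P j i) (u n q k l) = \<zero>\<^bsub>Lam n q P\<^esub>"
    if ij: "(i, j) \<in> pos_roots n" and kl: "k \<in> {1..n+1}" "l \<in> {1..n+1}" "k \<noteq> l"
      and not_shift: "\<not> (l = j \<and> (j, k) \<in> pos_roots n)" for i j k l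
  proof -
    have "(k, l) \<in> O_gens n" "\<not> (l = j \<and> j < k)"
      using ij kl not_shift by (auto simp: O_gens_def pos_roots_def)
    then show ?thesis
      using e01_action[OF ij] linear_part_gen_gen[OF ij] kl(3) by (auto simp: Lam_zero)
  qed
  show ?thesis
    using I01_right_ideal I01_generated Lam_basis_e01 diagonal shift other by blast
qed

end
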